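(* There is an algorithm that, given a bicolored interval graph on $n$ vertices, solves the Balanced Connected Subgraph problem (BCS) on it in $O(n^3)$ time.
   Context: All graphs are finite, simple and undirected. A graph is bicolored if every vertex is colored blue or red (adjacent vertices may have the same color); $B$ and $R$ denote the sets of blue and red vertices. The Balanced Connected Subgraph problem (BCS): the input is a bicolored graph $G=(B\cup R,E)$; the output is a connected induced subgraph $H$ of $G$ with $|V(H)\cap B|=|V(H)\cap R|$ having the maximum number of vertices. The empty subgraph (of size $0$) counts as feasible, so an optimum always exists. A graph is an interval graph if one can assign to each vertex an interval of the real line such that two distinct vertices are adjacent if and only if their intervals intersect. Running times are in the standard unit-cost RAM model. *)

theory Defs
  imports "HOL-Analysis.Analysis" "HOL-Library.Landau_Symbols"
begin

record 'a bicolored =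
  blue :: "'a set"
  red :: "'a set"
  edges :: "'a set set"

definition verts :: "'a bicolored \<Rightarrow> 'a set" where
  "verts G = blue G \<union> red G"

definition bicolored_graph :: "'a bicolored \<Rightarrow> bool" where
  "bicolored_graph G \<longleftrightarrow>
     finite (verts G) \<and> blue G \<inter> red G = {} \<and>
     (\<forall>e \<in> edges G. \<exists>u \<in> verts G. \<exists>v \<in> verts G. u \<noteq> v \<and> e = {u, v})"

definition interval_graph :: "'a bicolored \<Rightarrow> bool" where
  "interval_graph G \<longleftrightarrow>
     (\<exists>I :: 'a \<Rightarrow> real set.
        (\<forall>v \<in> verts G. is_interval (I v) \<and> I v \<noteq> {}) \<and>
        (\<forall>u \<in> verts G. \<forall>v \<in> verts G. u \<noteq> v \<longrightarrow>
           ({u, v} \<in> edges G \<longleftrightarrow> I u \<inter> I v \<noteq> {})))"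

definition induced_subgraph :: "'a bicolored \<Rightarrow> 'a set \<Rightarrow> 'a bicolored" where
  "induced_subgraph G W =
     \<lparr>blue = blue G \<inter> W, red = red G \<inter> W, edges = {e \<in> edges G. e \<subseteq> W}\<rparr>"

text \<open>The empty graph is connected under this definition, so that the empty subgraph is feasible
  below.\<close>

definition connected_graph :: "'a bicolored \<Rightarrow> bool" where
  "connected_graph H \<longleftrightarrow>
     (\<forall>u \<in> verts H. \<forall>v \<in> verts H. (u, v) \<in> {(x, y). {x, y} \<in> edges H}\<^sup>*)"

definition bcs_feasible :: "'a bicolored \<Rightarrow> 'a bicolored \<Rightarrow> bool" where
  "bcs_feasible G H \<longleftrightarrow>
     (\<exists>W \<subseteq> verts G. H = induced_subgraph G W) \<and> connected_graph H \<and>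
     card (blue H) = card (red H)"

definition bcs_optimal :: "'a bicolored \<Rightarrow> 'a bicolored \<Rightarrow> bool" where
  "bcs_optimal G H \<longleftrightarrow>
     bcs_feasible G H \<and> (\<forall>H'. bcs_feasible G H' \<longrightarrow> card (verts H') \<le> card (verts H))"

text \<open>The machine has the instruction set of Cook and Reckhow, over natural-number registers
  \<open>X\<^sub>0, X\<^sub>1, \<dots>\<close> with truncated subtraction. There is no multiplication or division. Input is read
  from a one-way tape of numbers (yielding \<open>0\<close> past its end), and output is appended to another.
  The machine halts when the program counter leaves the program.\<close>

datatype instr =
    Const nat nat
  | Add nat nat nat
  | Sub nat nat nat
  | Load nat nat
  | Store nat nat
  | Jump_pos nat nat
  | Read nat
  | Print nat

record config =
  pc :: nat
  reg :: "nat \<Rightarrow> nat"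
  inp :: "nat list"
  outp :: "nat list"

fun exec :: "instr \<Rightarrow> config \<Rightarrow> config" where
  "exec (Const i c) s = s\<lparr>pc := pc s + 1, reg := (reg s)(i := c)\<rparr>"
| "exec (Add i j k) s = s\<lparr>pc := pc s + 1, reg := (reg s)(i := reg s j + reg s k)\<rparr>"
| "exec (Sub i j k) s = s\<lparr>pc := pc s + 1, reg := (reg s)(i := reg s j - reg s k)\<rparr>"
| "exec (Load i j) s = s\<lparr>pc := pc s + 1, reg := (reg s)(i := reg s (reg s j))\<rparr>"
| "exec (Store i j) s = s\<lparr>pc := pc s + 1, reg := (reg s)(reg s i := reg s j)\<rparr>"
| "exec (Jump_pos j l) s = s\<lparr>pc := (if reg s j > 0 then l else pc s + 1)\<rparr>"
| "exec (Read i) s =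
     s\<lparr>pc := pc s + 1, reg := (reg s)(i := (case inp s of [] \<Rightarrow> 0 | x # _ \<Rightarrow> x)),
       inp := tl (inp s)\<rparr>"
| "exec (Print i) s = s\<lparr>pc := pc s + 1, outp := outp s @ [reg s i]\<rparr>"

definition halted :: "instr list \<Rightarrow> config \<Rightarrow> bool" where
  "halted P s \<longleftrightarrow> pc s \<ge> length P"

definition step :: "instr list \<Rightarrow> config \<Rightarrow> config" where
  "step P s = (if halted P s then s else exec (P ! pc s) s)"

definition initial :: "nat list \<Rightarrow> config" where
  "initial xs = \<lparr>pc = 0, reg = (\<lambda>_. 0), inp = xs, outp = []\<rparr>"

definition computes_within :: "instr list \<Rightarrow> nat list \<Rightarrow> nat \<Rightarrow> nat list \<Rightarrow> bool" where
  "computes_within P xs t ys \<longleftrightarrow>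
     (\<exists>k \<le> t. let s = (step P ^^ k) (initial xs) in halted P s \<and> outp s = ys)"

text \<open>A graph with vertices \<open>0, \<dots>, n - 1\<close> is presented as \<open>n\<close>, followed by the colors
  (\<open>1\<close> for blue, \<open>0\<close> for red) and the rows of the adjacency matrix. No interval representation
  is supplied.\<close>

definition encode_graph :: "nat \<Rightarrow> nat bicolored \<Rightarrow> nat list" where
  "encode_graph n G =
     n # map (\<lambda>v. if v \<in> blue G then 1 else 0) [0..<n]
       @ concat (map (\<lambda>u. map (\<lambda>v. if {u, v} \<in> edges G then 1 else 0) [0..<n]) [0..<n])"

end

theory Submission
  imports Defs
begin

text \<open>
  No interval representation is computed. If \<open>W\<close> is connected, \<open>s\<close> is a vertex of \<open>W\<close> whose interval
  ends first and \<open>t\<close> one whose interval begins last, then every connected set containing \<open>s\<close> and \<open>t\<close>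
  dominates \<open>W\<close>, and in fact dominates the set \<open>D\<close> of all vertices that end no earlier than \<open>s\<close> and
  begin no later than \<open>t\<close>. A connected set \<open>P\<close> containing \<open>s\<close> and \<open>t\<close> that is lightest for positive
  vertex weights is contained in \<open>D\<close>. Let weights favor the color that is more frequent in \<open>D\<close>, in the
  sense that a vertex of this color weighs \<open>n + 1\<close> and any other vertex weighs \<open>1\<close>. Then \<open>P\<close> has at most
  as many vertices of this color as \<open>W\<close>, so it extends inside its closed neighborhood to a balanced
  connected set at least as large as \<open>W\<close>. It therefore suffices to try, for both choices of the favored
  color and all \<open>s\<close> and \<open>t\<close>, a single lightest \<open>P\<close>. Dijkstra's algorithm from \<open>s\<close> finds these in
  quadratic time, and maintains their closed neighborhoods in linear time per settled vertex, since
  the one of \<open>t\<close> arises from that of its parent by adding the neighbors of \<open>t\<close>.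
\<close>

section \<open>A structured language and its compilation\<close>

text \<open>Why the extension exists: let \<open>c\<close> be the smaller of the two color counts of
  \<open>D\<close>. As \<open>P\<close> lies in \<open>D\<close>, it has at most \<open>c\<close>
  vertices of the rarer color. Of the favored color it has at most as many as \<open>W\<close>,
  hence also at most \<open>c\<close>, because \<open>W\<close> is balanced and lies in
  \<open>D\<close>. The closed neighborhood of \<open>P\<close> contains \<open>D\<close>, so it
  offers at least \<open>c\<close> vertices of each color, and adding any of them keeps
  \<open>P\<close> connected. The weight \<open>n + 1\<close> exceeds the number of other vertices
  that a set can have, so comparing weights compares the favored counts first. The weight
  \<open>1\<close> instead of \<open>0\<close> makes every removal of a vertex strictly profitable,
  which is what confines \<open>P\<close> to \<open>D\<close>. The set \<open>D\<close> depends on a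
  representation unknown to the program. So the program cannot tell which color is more frequent in
  it and tries both, and it judges \<open>P\<close> only by its closed neighborhood, which can be
  computed; \<open>served\<close> records the outcome. With a quadratic number of pairs
  \<open>s\<close>, \<open>t\<close>, only linear time is left for each.\<close>

datatype exp = Num nat | Var nat | Plus exp exp | Minus exp exp | Arr nat exp

datatype com =
    Skip
  | Assign nat exp
  | Update nat exp exp
  | Get nat
  | Put exp
  | Seq com com  (infixr ";;" 60)
  | Cond exp com com
  | For nat com

record state =
  var :: "nat \<Rightarrow> nat"
  arr :: "nat \<Rightarrow> nat \<Rightarrow> nat"
  ins :: "nat list"
  outs :: "nat list"

fun eval :: "exp \<Rightarrow> state \<Rightarrow> nat" where
  "eval (Num c) \<sigma> = c"
| "eval (Var x) \<sigma> = var \<sigma> x"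
| "eval (Plus a b) \<sigma> = eval a \<sigma> + eval b \<sigma>"
| "eval (Minus a b) \<sigma> = eval a \<sigma> - eval b \<sigma>"
| "eval (Arr a e) \<sigma> = arr \<sigma> a (eval e \<sigma>)"

definition set_var :: "nat \<Rightarrow> nat \<Rightarrow> state \<Rightarrow> state" where
  "set_var x c \<sigma> = \<sigma>\<lparr>var := (var \<sigma>)(x := c)\<rparr>"

definition set_arr :: "nat \<Rightarrow> nat \<Rightarrow> nat \<Rightarrow> state \<Rightarrow> state" where
  "set_arr a i c \<sigma> = \<sigma>\<lparr>arr := (arr \<sigma>)(a := (arr \<sigma> a)(i := c))\<rparr>"

lemma set_var_simps [simp]:
  "var (set_var x c \<sigma>) y = (if y = x then c else var \<sigma> y)"
  "arr (set_var x c \<sigma>) = arr \<sigma>"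
  "ins (set_var x c \<sigma>) = ins \<sigma>" "outs (set_var x c \<sigma>) = outs \<sigma>"
  by (simp_all add: set_var_def)

lemma set_arr_simps [simp]:
  "var (set_arr a i c \<sigma>) = var \<sigma>"
  "arr (set_arr a i c \<sigma>) b j = (if b = a \<and> j = i then c else arr \<sigma> b j)"
  "ins (set_arr a i c \<sigma>) = ins \<sigma>" "outs (set_arr a i c \<sigma>) = outs \<sigma>"
  by (simp_all add: set_arr_def)

lemma arr_set_arr_other [simp]: "b \<noteq> a \<Longrightarrow> arr (set_arr a i c \<sigma>) b = arr \<sigma> b"
  by (simp add: set_arr_def)

text \<open>Every loop runs its counter from \<open>0\<close> below the value of variable \<open>0\<close>, which holds the number
  of vertices. Hence execution is a total function and the running time is polynomial in that value,
  with the nesting depth of the loops as exponent.\<close>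

fun run :: "com \<Rightarrow> state \<Rightarrow> state" where
  "run Skip \<sigma> = \<sigma>"
| "run (Assign x e) \<sigma> = set_var x (eval e \<sigma>) \<sigma>"
| "run (Update a i e) \<sigma> = set_arr a (eval i \<sigma>) (eval e \<sigma>) \<sigma>"
| "run (Get x) \<sigma> = (set_var x (case ins \<sigma> of [] \<Rightarrow> 0 | c # _ \<Rightarrow> c) \<sigma>)\<lparr>ins := tl (ins \<sigma>)\<rparr>"
| "run (Put e) \<sigma> = \<sigma>\<lparr>outs := outs \<sigma> @ [eval e \<sigma>]\<rparr>"
| "run (c ;; d) \<sigma> = run d (run c \<sigma>)"
| "run (Cond e c d) \<sigma> = (if eval e \<sigma> > 0 then run c \<sigma> else run d \<sigma>)"
| "run (For x c) \<sigma> =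
     ((\<lambda>\<tau>. set_var x (Suc (var \<tau> x)) (run c \<tau>)) ^^ var \<sigma> 0) (set_var x 0 \<sigma>)"

fun writes :: "com \<Rightarrow> nat set" where
  "writes (Assign x e) = {x}"
| "writes (Get x) = {x}"
| "writes (c ;; d) = writes c \<union> writes d"
| "writes (Cond e c d) = writes c \<union> writes d"
| "writes (For x c) = insert x (writes c)"
| "writes _ = {}"

fun arr_writes :: "com \<Rightarrow> nat set" where
  "arr_writes (Update a i e) = {a}"
| "arr_writes (c ;; d) = arr_writes c \<union> arr_writes d"
| "arr_writes (Cond e c d) = arr_writes c \<union> arr_writes d"
| "arr_writes (For x c) = arr_writes c"
| "arr_writes _ = {}"

fun reads_input :: "com \<Rightarrow> bool" where
  "reads_input (Get x) = True"
| "reads_input (c ;; d) = (reads_input c \<or> reads_input d)"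
| "reads_input (Cond e c d) = (reads_input c \<or> reads_input d)"
| "reads_input (For x c) = reads_input c"
| "reads_input _ = False"

fun prints_output :: "com \<Rightarrow> bool" where
  "prints_output (Put x) = True"
| "prints_output (c ;; d) = (prints_output c \<or> prints_output d)"
| "prints_output (Cond e c d) = (prints_output c \<or> prints_output d)"
| "prints_output (For x c) = prints_output c"
| "prints_output _ = False"

text \<open>A relation between two states rather than a property of \<open>run c\<close>, because
  \<open>For_invariant\<close> also supplies it for the states between two iterations, relative to
  the state before the loop.\<close>

definition frame :: "com \<Rightarrow> state \<Rightarrow> state \<Rightarrow> bool" where
  "frame c \<sigma> \<tau> \<longleftrightarrow>
     (\<forall>x. x \<notin> writes c \<longrightarrow> var \<tau> x = var \<sigma> x) \<and> (\<forall>a. a \<notin> arr_writes c \<longrightarrow> arr \<tau> a = arr \<sigma> a) \<and>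
     (\<not> reads_input c \<longrightarrow> ins \<tau> = ins \<sigma>) \<and> (\<not> prints_output c \<longrightarrow> outs \<tau> = outs \<sigma>)"

lemma frame_For_iterate:
  assumes "\<And>\<tau>. frame c \<tau> (run c \<tau>)"
  shows "frame (For x c) \<sigma> (((\<lambda>\<tau>. set_var x (Suc (var \<tau> x)) (run c \<tau>)) ^^ k) (set_var x 0 \<sigma>))"
  using assms by (induction k) (simp_all add: frame_def)

lemma frame_run: "frame c \<sigma> (run c \<sigma>)"
proof (induction c arbitrary: \<sigma>)
  case (For x c)
  then show ?case using frame_For_iterate by simp
qed (auto simp: frame_def)

lemma run_frame:
  "x \<notin> writes c \<Longrightarrow> var (run c \<sigma>) x = var \<sigma> x"
  "a \<notin> arr_writes c \<Longrightarrow> arr (run c \<sigma>) a = arr \<sigma> a"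
  "\<not> reads_input c \<Longrightarrow> ins (run c \<sigma>) = ins \<sigma>"
  "\<not> prints_output c \<Longrightarrow> outs (run c \<sigma>) = outs \<sigma>"
  using frame_run[of c \<sigma>] by (simp_all add: frame_def)

text \<open>The step may use that the counter equals the index and that \<open>frame\<close> relates
  \<open>\<tau>\<close> to the initial state, so an invariant has to mention only what the loop
  changes.\<close>

lemma For_invariant:
  assumes "x \<notin> writes c" "I 0 (set_var x 0 \<sigma>)"
    and "\<And>i \<tau>. i < var \<sigma> 0 \<Longrightarrow> I i \<tau> \<Longrightarrow> var \<tau> x = i \<Longrightarrow> frame (For x c) \<sigma> \<tau> \<Longrightarrow>
           I (Suc i) (set_var x (Suc i) (run c \<tau>))"
  shows "I (var \<sigma> 0) (run (For x c) \<sigma>)"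
proof -
  let ?s = "\<lambda>k. ((\<lambda>\<tau>. set_var x (Suc (var \<tau> x)) (run c \<tau>)) ^^ k) (set_var x 0 \<sigma>)"
  have "k \<le> var \<sigma> 0 \<Longrightarrow> I k (?s k) \<and> var (?s k) x = k" for k
  proof (induction k)
    case (Suc k)
    then show ?case
      using assms(3)[of k "?s k"] frame_For_iterate[OF frame_run, of x c \<sigma> k] by simp
  qed (use assms in auto)
  then show ?thesis by simp
qed

subsection \<open>Compilation to the random access machine\<close>

text \<open>Variables live in registers below \<open>24\<close>, temporaries in registers \<open>24\<close> to \<open>31\<close>, and entry \<open>i\<close> of
  array \<open>a < 16\<close> in register \<open>32 + a + 16 * i\<close>, so that an address is found by four doublings.\<close>

abbreviation addr :: "nat \<Rightarrow> nat \<Rightarrow> instr list" where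
  "addr a t \<equiv> [Add t t t, Add t t t, Add t t t, Add t t t, Const (Suc t) (32 + a), Add t t (Suc t)]"

text \<open>The value is left in register \<open>t\<close>, and temporaries below \<open>t\<close>
  are preserved, so a left operand survives the evaluation of the right one. The machine has no move
  instruction; a variable is copied by adding zero.\<close>

fun comp_exp :: "exp \<Rightarrow> nat \<Rightarrow> instr list" where
  "comp_exp (Num c) t = [Const t c]"
| "comp_exp (Var x) t = [Const t 0, Add t x t]"
| "comp_exp (Plus a b) t = comp_exp a t @ comp_exp b (Suc t) @ [Add t t (Suc t)]"
| "comp_exp (Minus a b) t = comp_exp a t @ comp_exp b (Suc t) @ [Sub t t (Suc t)]"
| "comp_exp (Arr a e) t = comp_exp e t @ addr a t @ [Load t t]"

text \<open>The bound is \<open>31\<close> and not \<open>32\<close> because \<open>addr\<close>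
  also needs \<open>Suc t\<close> as a temporary.\<close>

fun wf_exp :: "exp \<Rightarrow> nat \<Rightarrow> bool" where
  "wf_exp (Num c) t \<longleftrightarrow> t < 31"
| "wf_exp (Var x) t \<longleftrightarrow> t < 31 \<and> x < 24"
| "wf_exp (Plus a b) t \<longleftrightarrow> wf_exp a t \<and> wf_exp b (Suc t)"
| "wf_exp (Minus a b) t \<longleftrightarrow> wf_exp a t \<and> wf_exp b (Suc t)"
| "wf_exp (Arr a e) t \<longleftrightarrow> wf_exp e t \<and> a < 16"

text \<open>Jump targets are absolute, hence the position \<open>p\<close>. The only jump is taken
  on a positive register, so the else-branch comes first and is left by a jump on a freshly loaded
  \<open>1\<close>. A loop enters by such a jump to its test, which stands behind the body.\<close>

fun comp :: "com \<Rightarrow> nat \<Rightarrow> instr list" where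
  "comp Skip p = []"
| "comp (Assign x e) p = comp_exp e 24 @ [Const 25 0, Add x 24 25]"
| "comp (Update a i e) p = comp_exp i 24 @ addr a 24 @ comp_exp e 25 @ [Store 24 25]"
| "comp (Get x) p = [Read x]"
| "comp (Put e) p = comp_exp e 24 @ [Print 24]"
| "comp (c ;; d) p = comp c p @ comp d (p + length (comp c p))"
| "comp (Cond e c d) p =
     (let p1 = p + length (comp_exp e 24) + 1; cd = comp d p1; p2 = p1 + length cd + 2;
          cc = comp c p2
      in comp_exp e 24 @ [Jump_pos 24 p2] @ cd @ [Const 24 1, Jump_pos 24 (p2 + length cc)] @ cc)"
| "comp (For x c) p =
     (let cc = comp c (p + 3)
      in [Const x 0, Const 24 1, Jump_pos 24 (p + 5 + length cc)] @ cc @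
         [Const 24 1, Add x x 24, Sub 24 0 x, Jump_pos 24 (p + 3)])"

text \<open>No command writes variable \<open>0\<close>, so all loops have the same bound and
  \<open>cost\<close> can be a function of that bound alone.\<close>

fun wf_com :: "com \<Rightarrow> bool" where
  "wf_com Skip \<longleftrightarrow> True"
| "wf_com (Assign x e) \<longleftrightarrow> 0 < x \<and> x < 24 \<and> wf_exp e 24"
| "wf_com (Update a i e) \<longleftrightarrow> a < 16 \<and> wf_exp i 24 \<and> wf_exp e 25"
| "wf_com (Get x) \<longleftrightarrow> 0 < x \<and> x < 24"
| "wf_com (Put e) \<longleftrightarrow> wf_exp e 24"
| "wf_com (c ;; d) \<longleftrightarrow> wf_com c \<and> wf_com d"
| "wf_com (Cond e c d) \<longleftrightarrow> wf_exp e 24 \<and> wf_com c \<and> wf_com d"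
| "wf_com (For x c) \<longleftrightarrow> 0 < x \<and> x < 24 \<and> x \<notin> writes c \<and> wf_com c"

text \<open>An upper bound on the machine steps: a conditional is charged for both branches. In a
  loop, \<open>4\<close> pays for the test and the increment of each pass, \<open>5\<close> for the
  three entry instructions and the last test.\<close>

fun cost :: "com \<Rightarrow> nat \<Rightarrow> nat" where
  "cost Skip n = 0"
| "cost (Assign x e) n = length (comp_exp e 24) + 2"
| "cost (Update a i e) n = length (comp_exp i 24) + length (comp_exp e 25) + 7"
| "cost (Get x) n = 1"
| "cost (Put e) n = length (comp_exp e 24) + 1"
| "cost (c ;; d) n = cost c n + cost d n"
| "cost (Cond e c d) n = length (comp_exp e 24) + 3 + cost c n + cost d n"
| "cost (For x c) n = 5 + n * (cost c n + 4)"

fun depth :: "com \<Rightarrow> nat" where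
  "depth (c ;; d) = max (depth c) (depth d)"
| "depth (Cond e c d) = max (depth c) (depth d)"
| "depth (For x c) = Suc (depth c)"
| "depth _ = 0"

text \<open>The base \<open>Suc n\<close> is at least \<open>1\<close>, also for
  \<open>n = 0\<close>, so constants and lower powers are absorbed by the highest power.\<close>

lemma cost_polynomial: "\<exists>C. \<forall>n. cost c n \<le> C * Suc n ^ depth c"
proof (induction c)
  case (Seq c d)
  then obtain C D where *: "\<And>n. cost c n \<le> C * Suc n ^ depth c" "\<And>n. cost d n \<le> D * Suc n ^ depth d"
    by auto
  have "cost (c ;; d) n \<le> (C + D) * Suc n ^ depth (c ;; d)" for n
  proof -
    have "Suc n ^ depth c \<le> Suc n ^ depth (c ;; d)" "Suc n ^ depth d \<le> Suc n ^ depth (c ;; d)"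
      by (auto intro!: power_increasing)
    then show ?thesis
      using * by (simp add: add_mult_distrib) (meson add_mono mult_le_mono2 order_trans)
  qed
  then show ?case by blast
next
  case (Cond e c d)
  then obtain C D where *: "\<And>n. cost c n \<le> C * Suc n ^ depth c" "\<And>n. cost d n \<le> D * Suc n ^ depth d"
    by auto
  let ?k = "max (depth c) (depth d)"
  have "cost (Cond e c d) n \<le> (length (comp_exp e 24) + 3 + C + D) * Suc n ^ ?k" for n
  proof -
    have "Suc n ^ depth c \<le> Suc n ^ ?k" "Suc n ^ depth d \<le> Suc n ^ ?k"
      by (auto intro!: power_increasing)
    then have "cost c n \<le> C * Suc n ^ ?k" "cost d n \<le> D * Suc n ^ ?k"
      using * by (meson mult_le_mono2 order_trans)+
    moreover have "length (comp_exp e 24) + 3 \<le> (length (comp_exp e 24) + 3) * Suc n ^ ?k"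
      by simp
    ultimately show ?thesis by (simp only: add_mult_distrib cost.simps)
  qed
  then show ?case by (auto simp only: depth.simps)
next
  case (For x c)
  then obtain C where *: "\<And>n. cost c n \<le> C * Suc n ^ depth c" by auto
  have "cost (For x c) n \<le> (9 + C) * Suc n ^ depth (For x c)" for n
  proof -
    have "cost (For x c) n \<le> 9 * Suc n + Suc n * cost c n" by (simp add: algebra_simps)
    also have "\<dots> \<le> 9 * (Suc n * Suc n ^ depth c) + Suc n * (C * Suc n ^ depth c)"
    proof (rule add_mono)
      have "Suc n * 1 \<le> Suc n * Suc n ^ depth c" by (rule mult_le_mono2) simp
      then show "9 * Suc n \<le> 9 * (Suc n * Suc n ^ depth c)" by simp
      show "Suc n * cost c n \<le> Suc n * (C * Suc n ^ depth c)" using * by (rule mult_le_mono2)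
    qed
    finally show ?thesis by (simp add: algebra_simps)
  qed
  then show ?case by blast
qed auto

section \<open>Correctness and running time of compiled code\<close>

fun is_jump :: "instr \<Rightarrow> bool" where
  "is_jump (Jump_pos _ _) = True"
| "is_jump _ = False"

definition code_at :: "instr list \<Rightarrow> nat \<Rightarrow> instr list \<Rightarrow> bool" where
  "code_at P p is \<longleftrightarrow> (\<exists>xs ys. P = xs @ is @ ys \<and> length xs = p)"

lemma code_at_append:
  "code_at P p (is @ js) \<longleftrightarrow> code_at P p is \<and> code_at P (p + length is) js"
proof
  assume "code_at P p is \<and> code_at P (p + length is) js"
  then obtain xs ys zs ws where "P = xs @ is @ ys" "length xs = p"
      "P = zs @ js @ ws" "length zs = p + length is"
    unfolding code_at_def by blast
  then have "zs = xs @ is \<and> js @ ws = ys"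
    by (intro append_eq_append_conv[THEN iffD1]) auto
  then show "code_at P p (is @ js)"
    using \<open>P = xs @ is @ ys\<close> \<open>length xs = p\<close> by (auto simp: code_at_def)
next
  assume "code_at P p (is @ js)"
  then obtain xs ys where "P = xs @ (is @ js) @ ys" "length xs = p" by (auto simp: code_at_def)
  then have "P = xs @ is @ (js @ ys)" "P = (xs @ is) @ js @ ys" "length (xs @ is) = p + length is"
    by auto
  with \<open>length xs = p\<close> show "code_at P p is \<and> code_at P (p + length is) js"
    unfolding code_at_def by blast
qed

lemma code_at_Cons:
  "code_at P p (i # is) \<longleftrightarrow> p < length P \<and> P ! p = i \<and> code_at P (Suc p) is"
proof -
  have "code_at P p [i] \<longleftrightarrow> p < length P \<and> P ! p = i"
    by (fastforce simp: code_at_def dest: id_take_nth_drop[of p P]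
      intro: exI[of _ "take p P"] exI[of _ "drop (Suc p) P"])
  then show ?thesis using code_at_append[of P p "[i]" "is"] by simp
qed

lemma exec_straight:
  assumes "code_at P (pc s) is" "\<forall>i \<in> set is. \<not> is_jump i"
  shows "(step P ^^ length is) s = fold exec is s \<and> pc (fold exec is s) = pc s + length is"
  using assms
proof (induction "is" arbitrary: s)
  case (Cons i "is")
  have "pc (exec i s) = Suc (pc s)" using Cons.prems(2) by (cases i) auto
  moreover have "step P s = exec i s"
    using Cons.prems(1) by (simp add: step_def halted_def code_at_Cons)
  ultimately show ?case
    using Cons.IH[of "exec i s"] Cons.prems by (simp_all add: code_at_Cons funpow_swap1)
qed auto

definition same_outside :: "nat \<Rightarrow> config \<Rightarrow> config \<Rightarrow> bool" where
  "same_outside t s s' \<longleftrightarrow>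
     (\<forall>r. r < t \<or> 32 \<le> r \<longrightarrow> reg s' r = reg s r) \<and> inp s' = inp s \<and> outp s' = outp s"

definition represents :: "config \<Rightarrow> state \<Rightarrow> bool" where
  "represents s \<sigma> \<longleftrightarrow>
     (\<forall>x < 24. reg s x = var \<sigma> x) \<and> (\<forall>a < 16. \<forall>i. reg s (32 + a + 16 * i) = arr \<sigma> a i) \<and>
     inp s = ins \<sigma> \<and> outp s = outs \<sigma>"

lemma represents_same_outside:
  "represents s \<sigma> \<Longrightarrow> same_outside t s s' \<Longrightarrow> 24 \<le> t \<Longrightarrow> represents s' \<sigma>"
  by (simp add: represents_def same_outside_def)

lemma same_outside_trans:
  "same_outside t s s' \<Longrightarrow> same_outside u s' s'' \<Longrightarrow> t \<le> u \<Longrightarrow> same_outside t s s''"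
  by (simp add: same_outside_def)

lemma comp_exp_straight: "i \<in> set (comp_exp e t) \<Longrightarrow> \<not> is_jump i"
  by (induction e t rule: comp_exp.induct) auto

lemma wf_exp_bound: "wf_exp e t \<Longrightarrow> t < 31"
  by (induction e t rule: wf_exp.induct) auto

lemma exec_addr:
  assumes "t < 31"
  shows "reg (fold exec (addr a t) s) t = 32 + a + 16 * reg s t"
    "same_outside t s (fold exec (addr a t) s)"
  using assms by (simp_all add: same_outside_def)

lemma exec_comp_exp:
  assumes "represents s \<sigma>" "wf_exp e t" "24 \<le> t"
  shows "reg (fold exec (comp_exp e t) s) t = eval e \<sigma> \<and> same_outside t s (fold exec (comp_exp e t) s)"
  using assms
proof (induction e t arbitrary: s rule: comp_exp.induct)
  case (1 c t)
  then show ?case by (simp add: same_outside_def)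
next
  case (2 x t)
  then show ?case by (simp add: same_outside_def represents_def)
next
  case (3 a b t)
  let ?s = "fold exec (comp_exp a t) s"
  let ?s' = "fold exec (comp_exp b (Suc t)) ?s"
  from 3 have a: "reg ?s t = eval a \<sigma>" "same_outside t s ?s" by simp_all
  then have "represents ?s \<sigma>" using 3 represents_same_outside by blast
  then have b: "reg ?s' (Suc t) = eval b \<sigma>" "same_outside (Suc t) ?s ?s'" using 3 by simp_all
  then have "reg ?s' t = eval a \<sigma>" "same_outside t s ?s'"
    using a same_outside_trans[OF a(2) b(2)] by (simp_all add: same_outside_def)
  then show ?case using b wf_exp_bound[of a t] 3(4) by (simp add: same_outside_def)
next
  case (4 a b t)
  let ?s = "fold exec (comp_exp a t) s"
  let ?s' = "fold exec (comp_exp b (Suc t)) ?s"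
  from 4 have a: "reg ?s t = eval a \<sigma>" "same_outside t s ?s" by simp_all
  then have "represents ?s \<sigma>" using 4 represents_same_outside by blast
  then have b: "reg ?s' (Suc t) = eval b \<sigma>" "same_outside (Suc t) ?s ?s'" using 4 by simp_all
  then have "reg ?s' t = eval a \<sigma>" "same_outside t s ?s'"
    using a same_outside_trans[OF a(2) b(2)] by (simp_all add: same_outside_def)
  then show ?case using b wf_exp_bound[of a t] 4(4) by (simp add: same_outside_def)
next
  case (5 a e t)
  let ?s = "fold exec (comp_exp e t) s"
  let ?s' = "fold exec (addr a t) ?s"
  have t: "t < 31" using 5 wf_exp_bound by auto
  from 5 have e: "reg ?s t = eval e \<sigma>" "same_outside t s ?s" by simp_all
  note s' = exec_addr[OF t, where a = a and s = ?s]
  have "same_outside t s ?s'" using same_outside_trans[OF e(2) s'(2)] by simp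
  moreover from this have "represents ?s' \<sigma>"
    by (rule represents_same_outside[OF 5(2)]) (use 5 in simp)
  moreover have "reg ?s' t = 32 + a + 16 * eval e \<sigma>" using s'(1) e(1) by simp
  \<comment> \<open>The name \<open>u\<close> hides the long \<open>fold\<close> term, so that the
    state before the load is atomic for the simplifier.\<close>
  moreover obtain u where "u = ?s'" by simp
  moreover from this have "fold exec (comp_exp (Arr a e) t) s = exec (Load t t) u" by simp
  moreover note \<open>represents s \<sigma>\<close>
  ultimately have "represents u \<sigma>" "same_outside t s u" "reg u t = 32 + a + 16 * eval e \<sigma>"
      "fold exec (comp_exp (Arr a e) t) s = exec (Load t t) u" by simp_all
  then show ?case
    using 5(3) t by (simp add: same_outside_def represents_def)
qed

definition reaches :: "instr list \<Rightarrow> config \<Rightarrow> nat \<Rightarrow> state \<Rightarrow> nat \<Rightarrow> bool" where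
  "reaches P s q \<sigma> k \<longleftrightarrow>
     (\<exists>j \<le> k. pc ((step P ^^ j) s) = q \<and> represents ((step P ^^ j) s) \<sigma>)"

lemma reaches_trans:
  assumes "reaches P s q \<sigma> k"
    and "\<And>s'. pc s' = q \<Longrightarrow> represents s' \<sigma> \<Longrightarrow> reaches P s' q' \<sigma>' k'"
  shows "reaches P s q' \<sigma>' (k + k')"
proof -
  obtain j where j: "j \<le> k" "pc ((step P ^^ j) s) = q" "represents ((step P ^^ j) s) \<sigma>"
    using assms(1) by (auto simp: reaches_def)
  then obtain j' where "j' \<le> k'" "pc ((step P ^^ j') ((step P ^^ j) s)) = q'"
      "represents ((step P ^^ j') ((step P ^^ j) s)) \<sigma>'"
    using assms(2)[of "(step P ^^ j) s"] by (auto simp: reaches_def)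
  then show ?thesis
    using j(1) unfolding reaches_def
    by (intro exI[of _ "j' + j"]) (simp add: funpow_add)
qed

lemma reaches_mono: "reaches P s q \<sigma> k \<Longrightarrow> k \<le> k' \<Longrightarrow> reaches P s q \<sigma> k'"
  by (auto simp: reaches_def intro: order_trans)

lemma reaches_straight:
  assumes "code_at P (pc s) is" "\<forall>i \<in> set is. \<not> is_jump i"
    and "represents (fold exec is s) \<sigma>"
  shows "reaches P s (pc s + length is) \<sigma> (length is)"
  using exec_straight[OF assms(1,2)] assms(3) by (auto simp: reaches_def)

lemma reaches_jump:
  assumes "code_at P (pc s) [Jump_pos r l]" "represents s \<sigma>"
  shows "reaches P s (if reg s r > 0 then l else Suc (pc s)) \<sigma> 1"
proof -
  have "step P s = exec (Jump_pos r l) s"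
    using assms by (simp add: step_def halted_def code_at_Cons)
  then show ?thesis using assms unfolding reaches_def
    by (intro exI[of _ 1]) (auto simp: represents_def)
qed

lemma reaches_straight_jump:
  assumes "code_at P (pc s) (is @ [Jump_pos r l])" "\<forall>i \<in> set is. \<not> is_jump i"
    and "represents (fold exec is s) \<sigma>"
  shows "reaches P s (if reg (fold exec is s) r > 0 then l else Suc (pc s + length is)) \<sigma>
           (length is + 1)"
proof -
  note e = exec_straight[of P s "is", THEN conjunct1] exec_straight[of P s "is", THEN conjunct2]
  have c: "code_at P (pc s) is" "code_at P (pc s + length is) [Jump_pos r l]"
    using assms(1) by (simp_all add: code_at_append)
  let ?s = "fold exec is s"
  have "reaches P ?s (if reg ?s r > 0 then l else Suc (pc ?s)) \<sigma> 1"
    using c assms e by (intro reaches_jump) auto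
  then obtain j where j: "j \<le> 1" "pc ((step P ^^ j) ?s) = (if reg ?s r > 0 then l else Suc (pc ?s))"
      "represents ((step P ^^ j) ?s) \<sigma>" by (auto simp: reaches_def)
  have "(step P ^^ (j + length is)) s = (step P ^^ j) ?s"
    using e(1)[OF c(1) assms(2)] by (simp add: funpow_add)
  then show ?thesis using j e(2)[OF c(1) assms(2)] unfolding reaches_def
    by (intro exI[of _ "j + length is"]) simp
qed

lemma run_var_0: "wf_com c \<Longrightarrow> var (run c \<sigma>) 0 = var \<sigma> 0"
proof -
  have "wf_com c \<Longrightarrow> 0 \<notin> writes c" by (induction c) auto
  then show "wf_com c \<Longrightarrow> var (run c \<sigma>) 0 = var \<sigma> 0" by (simp add: run_frame)
qed

theorem comp_correct:
  assumes "wf_com c" "code_at P p (comp c p)" "pc s = p" "represents s \<sigma>"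
  shows "reaches P s (p + length (comp c p)) (run c \<sigma>) (cost c (var \<sigma> 0))"
  using assms
proof (induction c arbitrary: p s \<sigma>)
  case Skip
  then show ?case by (auto simp: reaches_def intro: exI[of _ 0])
next
  case (Assign x e)
  have "represents (fold exec (comp (Assign x e) p) s) (run (Assign x e) \<sigma>)"
    using exec_comp_exp[of s \<sigma> e 24] Assign
    by (auto simp: represents_def same_outside_def)
  then show ?case
    using Assign reaches_straight[of P s "comp (Assign x e) p"] comp_exp_straight by fastforce
next
  case (Update a i e)
  let ?s = "fold exec (comp_exp i 24) s"
  let ?s' = "fold exec (addr a 24) ?s"
  let ?s'' = "fold exec (comp_exp e 25) ?s'"
  from Update have i: "reg ?s 24 = eval i \<sigma>" "same_outside 24 s ?s"
    using exec_comp_exp[of s \<sigma> i 24] by auto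
  note s' = exec_addr[where t = 24 and a = a and s = ?s]
  have s2: "same_outside 24 s ?s'" using same_outside_trans[OF i(2) s'(2)] by simp
  then have "represents ?s' \<sigma>" by (rule represents_same_outside[OF Update.prems(4)]) simp
  then have e: "reg ?s'' 25 = eval e \<sigma>" "same_outside 25 ?s' ?s''"
    using exec_comp_exp[of ?s' \<sigma> e 25] Update by simp_all
  have 24: "reg ?s'' 24 = 32 + a + 16 * eval i \<sigma>"
    using e(2) s'(1) i by (simp add: same_outside_def)
  have "same_outside 24 s ?s''" using same_outside_trans[OF s2 e(2)] by simp
  then have "represents ?s'' \<sigma>" by (rule represents_same_outside[OF Update.prems(4)]) simp
  \<comment> \<open>Residues modulo 16 separate the arrays, so a store changes exactly one entry of
    one array.\<close>
  moreover have "(32 + b + 16 * j = 32 + a + 16 * k) = (b = a \<and> j = k)" if "b < 16" for b j k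
    using that Update.prems(1) by auto presburger+
  moreover obtain u where "u = ?s''" by simp
  moreover from this have "fold exec (comp (Update a i e) p) s = exec (Store 24 25) u" by simp
  ultimately have rep: "represents (fold exec (comp (Update a i e) p) s) (run (Update a i e) \<sigma>)"
    using 24 e(1) by (simp add: represents_def)
  have "\<forall>i \<in> set (comp (Update a i e) p). \<not> is_jump i"
    using comp_exp_straight by auto
  moreover have "length (comp (Update a i e) p) = cost (Update a i e) (var \<sigma> 0)" by simp
  ultimately show ?case
    using Update.prems(2,3) reaches_straight[OF _ _ rep, of P] by metis
next
  case (Get x)
  have "represents (fold exec (comp (Get x) p) s) (run (Get x) \<sigma>)"
    using Get by (auto simp: represents_def)
  then show ?case
    using Get reaches_straight[of P s "comp (Get x) p"] by fastforce
next
  case (Put e)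
  have "represents (fold exec (comp (Put e) p) s) (run (Put e) \<sigma>)"
    using exec_comp_exp[of s \<sigma> e 24] Put
    by (auto simp: represents_def same_outside_def)
  then show ?case
    using Put reaches_straight[of P s "comp (Put e) p"] comp_exp_straight by fastforce
next
  case (Seq c d)
  let ?q = "p + length (comp c p)"
  have code: "code_at P p (comp c p)" "code_at P ?q (comp d ?q)"
    using Seq.prems(2) by (simp_all add: code_at_append)
  have wf: "wf_com c" "wf_com d" using Seq.prems(1) by simp_all
  have "reaches P s (?q + length (comp d ?q)) (run d (run c \<sigma>)) (cost c (var \<sigma> 0) + cost d (var \<sigma> 0))"
  proof (rule reaches_trans)
    show "reaches P s ?q (run c \<sigma>) (cost c (var \<sigma> 0))"
      by (rule Seq.IH(1)[OF wf(1) code(1) Seq.prems(3,4)])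
    show "reaches P s' (?q + length (comp d ?q)) (run d (run c \<sigma>)) (cost d (var \<sigma> 0))"
      if "pc s' = ?q" "represents s' (run c \<sigma>)" for s'
      using Seq.IH(2)[OF wf(2) code(2) that] run_var_0[OF wf(1)] by simp
  qed
  then show ?case by (simp add: add.assoc)
next
  case (Cond e c d)
  define p1 where "p1 = p + length (comp_exp e 24) + 1"
  define cd where "cd = comp d p1"
  define p2 where "p2 = p1 + length cd + 2"
  define cc where "cc = comp c p2"
  define q where "q = p2 + length cc"
  have comp: "comp (Cond e c d) p = (comp_exp e 24 @ [Jump_pos 24 p2]) @ cd @ [Const 24 1, Jump_pos 24 q] @ cc"
    by (simp add: Let_def p1_def cd_def p2_def cc_def q_def)
  have q: "p + length (comp (Cond e c d) p) = q"
    unfolding comp by (simp add: q_def p2_def p1_def)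
  have code: "code_at P p (comp_exp e 24 @ [Jump_pos 24 p2])" "code_at P p1 cd"
      "code_at P (p1 + length cd) [Const 24 1, Jump_pos 24 q]" "code_at P p2 cc"
    using Cond.prems(2) unfolding comp code_at_append
    by (simp_all add: p1_def p2_def add.assoc) (simp add: add.commute)?
  let ?s = "fold exec (comp_exp e 24) s"
  have e: "reg ?s 24 = eval e \<sigma>" "same_outside 24 s ?s"
    using exec_comp_exp[of s \<sigma> e 24] Cond by auto
  then have "represents ?s \<sigma>" using Cond.prems represents_same_outside by blast
  then have first: "reaches P s (if eval e \<sigma> > 0 then p2 else p1) \<sigma> (length (comp_exp e 24) + 1)"
    using reaches_straight_jump[of P s "comp_exp e 24" 24 p2 \<sigma>] code(1) Cond.prems(3) e(1)
    by (auto simp: p1_def comp_exp_straight split: if_splits)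
  show ?case
  proof (cases "eval e \<sigma> > 0")
    case True
    have "reaches P s' q (run c \<sigma>) (cost c (var \<sigma> 0))" if "pc s' = p2" "represents s' \<sigma>" for s'
      using Cond.IH(1)[of p2 s' \<sigma>] Cond.prems(1) code(4) that by (simp add: q_def cc_def)
    with first True have "reaches P s q (run c \<sigma>) (length (comp_exp e 24) + 1 + cost c (var \<sigma> 0))"
      by (intro reaches_trans[of P s p2 \<sigma> "length (comp_exp e 24) + 1"]) simp_all
    then show ?thesis using True q by (auto elim: reaches_mono)
  next
    case False
    have "reaches P s' (p1 + length cd) (run d \<sigma>) (cost d (var \<sigma> 0))"
      if "pc s' = p1" "represents s' \<sigma>" for s'
      using Cond.IH(2)[of p1 s' \<sigma>] Cond.prems(1) code(2) that by (simp add: cd_def)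
    with first False have
      "reaches P s (p1 + length cd) (run d \<sigma>) (length (comp_exp e 24) + 1 + cost d (var \<sigma> 0))"
      by (intro reaches_trans[of P s p1 \<sigma> "length (comp_exp e 24) + 1"]) simp_all
    moreover have "reaches P s' q (run d \<sigma>) 2"
      if "pc s' = p1 + length cd" "represents s' (run d \<sigma>)" for s'
      using reaches_straight_jump[of P s' "[Const 24 1]" 24 q "run d \<sigma>"] code(3) that
      by (auto simp: represents_def numeral_2_eq_2)
    ultimately have "reaches P s q (run d \<sigma>) (length (comp_exp e 24) + 1 + cost d (var \<sigma> 0) + 2)"
      by (rule reaches_trans)
    then show ?thesis using False q by (auto elim: reaches_mono)
  qed
next
  case (For x c)
  define cc where "cc = comp c (p + 3)"
  define q where "q = p + 5 + length cc"
  let ?f = "\<lambda>\<tau>. set_var x (Suc (var \<tau> x)) (run c \<tau>)"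
  let ?n = "var \<sigma> 0"
  define start where "start = [Const x 0, Const 24 1] @ [Jump_pos 24 q]"
  define incr where "incr = [Const 24 1, Add x x 24]"
  define test where "test = [Sub 24 0 x] @ [Jump_pos 24 (p + 3)]"
  have comp: "comp (For x c) p = start @ cc @ incr @ test"
    by (simp add: Let_def cc_def q_def start_def incr_def test_def)
  have "p + length start = p + 3" "p + 3 + length cc + length incr = q"
    by (simp_all add: start_def incr_def q_def)
  then have code: "code_at P p start" "code_at P (p + 3) cc" "code_at P (p + 3 + length cc) incr"
      "code_at P q test"
    using For.prems(2) unfolding comp code_at_append by simp_all
  have x: "0 < x" "x < 24" "x \<notin> writes c" "wf_com c" using For.prems by auto
  have state: "var ((?f ^^ k) (set_var x 0 \<sigma>)) 0 = ?n" "var ((?f ^^ k) (set_var x 0 \<sigma>)) x = k" for k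
    using x by (induction k) (auto simp: run_var_0 run_frame)
  \<comment> \<open>Passes are measured from test to test: after \<open>k\<close> of them control is
    at \<open>q\<close>, where the test begins. The \<open>3\<close> are the entry
    instructions.\<close>
  have loop: "reaches P s q ((?f ^^ k) (set_var x 0 \<sigma>)) (3 + k * (cost c ?n + 4))" if "k \<le> ?n" for k
    using that
  proof (induction k)
    case 0
    show ?case
      using reaches_straight_jump[of P s "[Const x 0, Const 24 1]" 24 q "set_var x 0 \<sigma>"]
        code(1)[unfolded start_def] For.prems x by (auto simp: represents_def numeral_3_eq_3)
  next
    case (Suc k)
    let ?\<tau> = "(?f ^^ k) (set_var x 0 \<sigma>)"
    have "reaches P s q ?\<tau> (3 + k * (cost c ?n + 4))" using Suc by simp
    moreover have "reaches P s' q (?f ?\<tau>) (2 + cost c ?n + 2)"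
      if s': "pc s' = q" "represents s' ?\<tau>" for s'
    proof (intro reaches_trans)
      have r: "represents (fold exec [Sub 24 0 x] s') ?\<tau>"
        using s' by (simp add: represents_def)
      have "reg s' 0 = ?n" "reg s' x = k"
        using s' x state[of k] by (auto simp: represents_def)
      then have "reg (fold exec [Sub 24 0 x] s') 24 > 0"
        using Suc.prems x by simp
      then show "reaches P s' (p + 3) ?\<tau> 2"
        using reaches_straight_jump[of P s' "[Sub 24 0 x]" 24 "p + 3" ?\<tau>] code(4)[unfolded test_def] s' r
        by (simp add: numeral_2_eq_2)
      show "reaches P s'' (p + 3 + length cc) (run c ?\<tau>) (cost c ?n)"
        if "pc s'' = p + 3" "represents s'' ?\<tau>" for s''
        using For.IH[OF x(4), of "p + 3" s'' ?\<tau>] code(2) that state(1)[of k] by (simp add: cc_def)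
      show "reaches P s'' q (?f ?\<tau>) 2"
        if "pc s'' = p + 3 + length cc" "represents s'' (run c ?\<tau>)" for s''
      proof -
        have "represents (fold exec [Const 24 1, Add x x 24] s'') (?f ?\<tau>)"
          using that x state(2)[of k] by (auto simp: represents_def run_frame)
        then show ?thesis
          using reaches_straight[of P s'' "[Const 24 1, Add x x 24]" "?f ?\<tau>"]
            code(3)[unfolded incr_def] that
          by (simp add: q_def numeral_2_eq_2 add.commute add.left_commute)
      qed
    qed
    ultimately have "reaches P s q (?f ?\<tau>) (3 + k * (cost c ?n + 4) + (2 + cost c ?n + 2))"
      by (rule reaches_trans)
    then show ?case by (simp add: algebra_simps)
  qed
  have "reaches P s (q + 2) (run (For x c) \<sigma>) (3 + ?n * (cost c ?n + 4) + 2)"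
  proof (rule reaches_trans)
    show "reaches P s q (run (For x c) \<sigma>) (3 + ?n * (cost c ?n + 4))"
      using loop[of ?n] by simp
    fix s' assume s': "pc s' = q" "represents s' (run (For x c) \<sigma>)"
    have r: "represents (fold exec [Sub 24 0 x] s') (run (For x c) \<sigma>)"
      using s' by (simp add: represents_def)
    have "reg s' 0 = ?n" "reg s' x = ?n"
      using s' x state[of ?n] by (auto simp: represents_def)
    then have "reg (fold exec [Sub 24 0 x] s') 24 = 0" by simp
    then show "reaches P s' (q + 2) (run (For x c) \<sigma>) 2"
      using reaches_straight_jump[of P s' "[Sub 24 0 x]" 24 "p + 3"] code(4)[unfolded test_def] s' r
      by (simp add: numeral_2_eq_2)
  qed
  moreover have "p + length (comp (For x c) p) = q + 2"
    unfolding comp by (simp add: start_def incr_def test_def q_def)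
  ultimately show ?case by (auto elim: reaches_mono)
qed

section \<open>Connected sets and interval graphs\<close>

text \<open>Connectivity of the subgraph induced on \<open>X\<close>, expressed by closed subsets
  instead of paths: a connectivity proof then amounts to exhibiting one closed set. The empty set is
  linked, in agreement with the feasibility of the empty subgraph.\<close>

definition linked :: "('a \<Rightarrow> 'a \<Rightarrow> bool) \<Rightarrow> 'a set \<Rightarrow> bool" where
  "linked adj X \<longleftrightarrow>
     (\<forall>C \<subseteq> X. C \<noteq> {} \<longrightarrow> (\<forall>x\<in>C. \<forall>y\<in>X. adj x y \<longrightarrow> y \<in> C) \<longrightarrow> C = X)"

lemma linkedI:
  assumes "\<And>C. C \<subseteq> X \<Longrightarrow> C \<noteq> {} \<Longrightarrow>
    (\<And>x y. x \<in> C \<Longrightarrow> y \<in> X \<Longrightarrow> adj x y \<Longrightarrow> y \<in> C) \<Longrightarrow> X \<subseteq> C"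
  shows "linked adj X"
  unfolding linked_def
proof (intro allI impI subset_antisym)
  fix C assume "C \<subseteq> X" "C \<noteq> {}" "\<forall>x\<in>C. \<forall>y\<in>X. adj x y \<longrightarrow> y \<in> C"
  then show "X \<subseteq> C" by (intro assms) auto
qed

lemma linkedD:
  assumes "linked adj X" "C \<subseteq> X" "C \<noteq> {}" "\<And>x y. x \<in> C \<Longrightarrow> y \<in> X \<Longrightarrow> adj x y \<Longrightarrow> y \<in> C"
  shows "C = X"
  by (rule assms(1)[unfolded linked_def, rule_format]) (use assms(2-) in auto)

text \<open>A nonempty closed subset of \<open>W\<close> meets \<open>P\<close>, hence contains
  \<open>P\<close>, hence all of \<open>W\<close>. This serves both to add a single vertex and to
  pad \<open>P\<close> with arbitrary neighbors.\<close>

lemma linked_superset: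
  assumes "linked adj P" "P \<noteq> {}" "P \<subseteq> W" "\<forall>v\<in>W. v \<in> P \<or> (\<exists>p\<in>P. adj p v)" "symp adj"
  shows "linked adj W"
proof (rule linkedI)
  fix C assume C: "C \<subseteq> W" "C \<noteq> {}" "\<And>x y. x \<in> C \<Longrightarrow> y \<in> W \<Longrightarrow> adj x y \<Longrightarrow> y \<in> C"
  obtain v where v: "v \<in> C" using C by auto
  then consider "v \<in> P" | p where "p \<in> P" "adj p v" using assms(4) C(1) by blast
  then have "C \<inter> P \<noteq> {}"
  proof cases
    case 2
    then have "p \<in> C" using C(3)[OF v, of p] assms(3,5) by (meson subsetD sympD)
    then show ?thesis using 2 by blast
  qed (use v in blast)
  then have "C \<inter> P = P"
    using C assms by (intro linkedD[OF assms(1)]) auto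
  then have "P \<subseteq> C" by blast
  then show "W \<subseteq> C" using assms(4) C(3) by (meson subsetD subsetI)
qed

lemma linked_singleton: "linked adj {s}"
  by (auto simp: linked_def)

text \<open>Replaces the first edge by which a path from \<open>s\<close> leaves \<open>S\<close>: a
  maximal linked subset \<open>C\<close> of \<open>X \<inter> S\<close> around \<open>s\<close> has
  an edge to the rest of \<open>X\<close>, and maximality puts its other end outside
  \<open>S\<close>.\<close>

lemma linked_frontier:
  assumes X: "finite X" "linked adj X" "s \<in> X" "\<not> X \<subseteq> S" and "s \<in> S" "symp adj"
  obtains C x y where "C \<subseteq> X \<inter> S" "s \<in> C" "linked adj C" "x \<in> C" "y \<in> X - S" "adj x y"
proof -
  let ?F = "{C. C \<subseteq> X \<inter> S \<and> s \<in> C \<and> linked adj C}"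
  have "{s} \<in> ?F" using assms by (simp add: linked_singleton)
  moreover have "finite ?F" using X(1) by (auto intro: finite_subset[of _ "Pow X"])
  ultimately obtain C where C: "C \<in> ?F" "\<forall>D\<in>?F. C \<subseteq> D \<longrightarrow> C = D"
    using finite_has_maximal[of ?F] by (metis (no_types, lifting) empty_iff)
  have "C \<noteq> X" using C(1) X(4) by blast
  then obtain x y where xy: "x \<in> C" "y \<in> X" "adj x y" "y \<notin> C"
    using linkedD[OF X(2), of C] C(1) by blast
  have F: "C \<subseteq> X \<inter> S" "s \<in> C" "linked adj C" using C(1) by simp_all
  have "linked adj (insert y C)"
    by (rule linked_superset[OF F(3)]) (use F(2) xy assms(6) in auto)
  have "y \<notin> S"
  proof
    assume "y \<in> S"
    then have "insert y C \<in> ?F" using F xy(2) \<open>linked adj (insert y C)\<close> by simp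
    then have "C \<subseteq> insert y C \<longrightarrow> C = insert y C" by (rule bspec[OF C(2)])
    then show False using xy(4) subset_insertI[of C y] by (metis insertI1)
  qed
  then show thesis using that[of C x y] F xy by simp
qed

text \<open>The preimage of a closed subset is closed. Needed for the retractions onto
  \<open>s\<close> and \<open>t\<close>.\<close>

lemma linked_image:
  assumes "linked adj P" "\<And>x y. x \<in> P \<Longrightarrow> y \<in> P \<Longrightarrow> adj x y \<Longrightarrow> f x = f y \<or> adj (f x) (f y)"
  shows "linked adj (f ` P)"
proof (rule linkedI)
  fix C assume C: "C \<subseteq> f ` P" "C \<noteq> {}" "\<And>x y. x \<in> C \<Longrightarrow> y \<in> f ` P \<Longrightarrow> adj x y \<Longrightarrow> y \<in> C"
  have "{x\<in>P. f x \<in> C} = P"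
  proof (rule linkedD[OF assms(1)])
    show "{x \<in> P. f x \<in> C} \<noteq> {}" using C by blast
    fix x y assume "x \<in> {x \<in> P. f x \<in> C}" "y \<in> P" "adj x y"
    then show "y \<in> {x \<in> P. f x \<in> C}" using assms(2)[of x y] C(3)[of "f x" "f y"] by auto
  qed auto
  then show "f ` P \<subseteq> C" by auto
qed

lemma connected_induced_iff_linked:
  assumes "bicolored_graph G" "W \<subseteq> verts G"
  shows "connected_graph (induced_subgraph G W) \<longleftrightarrow> linked (\<lambda>u v. {u, v} \<in> edges G) W"
proof -
  let ?R = "{(x, y). {x, y} \<in> edges (induced_subgraph G W)}"
  have R: "(x, y) \<in> ?R \<longleftrightarrow> {x, y} \<in> edges G \<and> x \<in> W \<and> y \<in> W" for x y
    by (simp add: induced_subgraph_def)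
  have verts: "verts (induced_subgraph G W) = W"
    using assms(2) by (auto simp: verts_def induced_subgraph_def)
  show ?thesis
  proof
    assume con: "connected_graph (induced_subgraph G W)"
    show "linked (\<lambda>u v. {u, v} \<in> edges G) W"
    proof (rule linkedI)
      fix C assume C: "C \<subseteq> W" "C \<noteq> {}" "\<And>x y. x \<in> C \<Longrightarrow> y \<in> W \<Longrightarrow> {x, y} \<in> edges G \<Longrightarrow> y \<in> C"
      obtain x where x: "x \<in> C" using C by auto
      have "(x, y) \<in> ?R\<^sup>* \<Longrightarrow> y \<in> C" for y
      proof (induction rule: rtrancl_induct)
        case (step y z)
        then show ?case using C(3)[of y z] R[of y z] by blast
      qed (rule x)
      then show "W \<subseteq> C" using con x C(1) unfolding connected_graph_def verts by blast
    qed
  next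
    assume l: "linked (\<lambda>u v. {u, v} \<in> edges G) W"
    have "(u, v) \<in> ?R\<^sup>*" if uv: "u \<in> W" "v \<in> W" for u v
    proof -
      have "{y\<in>W. (u, y) \<in> ?R\<^sup>*} = W"
      proof (rule linkedD[OF l])
        show "{y\<in>W. (u, y) \<in> ?R\<^sup>*} \<noteq> {}" using uv by auto
        fix x y assume xy: "x \<in> {y\<in>W. (u, y) \<in> ?R\<^sup>*}" "y \<in> W" "{x, y} \<in> edges G"
        then have "(x, y) \<in> ?R" using R by blast
        with xy show "y \<in> {y\<in>W. (u, y) \<in> ?R\<^sup>*}"
          by (metis (no_types, lifting) mem_Collect_eq rtrancl_into_rtrancl)
      qed auto
      with uv show ?thesis by blast
    qed
    then show "connected_graph (induced_subgraph G W)" by (simp add: connected_graph_def verts)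
  qed
qed

lemma interval_graph_endpoints:
  assumes "bicolored_graph G" "interval_graph G"
  obtains L R :: "'a \<Rightarrow> real"
  where "\<And>v. v \<in> verts G \<Longrightarrow> L v \<le> R v"
    and "\<And>u v. u \<in> verts G \<Longrightarrow> v \<in> verts G \<Longrightarrow> u \<noteq> v \<Longrightarrow> {u, v} \<in> edges G \<longleftrightarrow> L u \<le> R v \<and> L v \<le> R u"
proof -
  obtain I :: "'a \<Rightarrow> real set" where
    I: "\<And>v. v \<in> verts G \<Longrightarrow> is_interval (I v) \<and> I v \<noteq> {}"
    and E: "\<And>u v. u \<in> verts G \<Longrightarrow> v \<in> verts G \<Longrightarrow> u \<noteq> v \<Longrightarrow> {u, v} \<in> edges G \<longleftrightarrow> I u \<inter> I v \<noteq> {}"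
    using assms(2) unfolding interval_graph_def by (elim exE conjE) (rule that, auto)
  \<comment> \<open>The given intervals may be open or unbounded. They are shrunk to closed ones
    spanned by finitely many points, one for each intersection.\<close>
  define p where "p u v = (SOME x. x \<in> I u \<inter> I v)" for u v
  have p: "p u v \<in> I u \<inter> I v" if "I u \<inter> I v \<noteq> {}" for u v
    using that unfolding p_def by (metis ex_in_conv someI)
  \<comment> \<open>\<open>SOME\<close> sees the same set in both orders, so a single point
    witnesses the intersection in both shrunken intervals.\<close>
  have p_sym: "p u v = p v u" for u v by (simp add: p_def Int_commute)
  define A where "A v = (\<lambda>u. p v u) ` {u \<in> verts G. I v \<inter> I u \<noteq> {}}" for v
  have A: "finite (A v)" "A v \<noteq> {}" "A v \<subseteq> I v" if "v \<in> verts G" for v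
    using that assms(1) I[OF that] p by (auto simp: A_def bicolored_graph_def)
  define L where "L v = Min (A v)" for v
  define R where "R v = Max (A v)" for v
  have LR: "L v \<in> A v" "R v \<in> A v" "L v \<le> R v" if "v \<in> verts G" for v
    using A[OF that] by (simp_all add: L_def R_def Min_le_iff)
  have sub: "{L v..R v} \<subseteq> I v" if "v \<in> verts G" for v
    using LR[OF that] A(3)[OF that] I[OF that] unfolding is_interval_1 by (meson atLeastAtMost_iff subsetD subsetI)
  show thesis
  proof (rule that[of L R])
    show "L v \<le> R v" if "v \<in> verts G" for v using LR that by blast
    fix u v assume uv: "u \<in> verts G" "v \<in> verts G" "u \<noteq> v"
    show "{u, v} \<in> edges G \<longleftrightarrow> L u \<le> R v \<and> L v \<le> R u"
    proof
      assume "{u, v} \<in> edges G"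
      then have ne: "I u \<inter> I v \<noteq> {}" using E uv by blast
      then have "p u v \<in> A u" "p v u \<in> A v"
        using uv unfolding A_def by blast+
      then have "L u \<le> p u v" "p u v \<le> R u" "L v \<le> p u v" "p u v \<le> R v"
        using A uv p_sym[of u v] by (auto simp: L_def R_def)
      then show "L u \<le> R v \<and> L v \<le> R u" by linarith
    next
      assume a: "L u \<le> R v \<and> L v \<le> R u"
      then have "max (L u) (L v) \<in> {L u..R u}" "max (L u) (L v) \<in> {L v..R v}"
        using LR uv by auto
      then show "{u, v} \<in> edges G" using sub uv E by blast
    qed
  qed
qed

text \<open>For positive weights and symmetric adjacency, \<open>P\<close> is the vertex set of a
  shortest path from \<open>s\<close> to \<open>t\<close>, with both ends counted.\<close>

definition least_linked :: "('a \<Rightarrow> 'a \<Rightarrow> bool) \<Rightarrow> 'a set \<Rightarrow> ('a \<Rightarrow> nat) \<Rightarrow> 'a \<Rightarrow> 'a \<Rightarrow> 'a set \<Rightarrow> bool" where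
  "least_linked adj V w s t P \<longleftrightarrow>
     P \<subseteq> V \<and> s \<in> P \<and> t \<in> P \<and> linked adj P \<and>
     (\<forall>X \<subseteq> V. s \<in> X \<longrightarrow> t \<in> X \<longrightarrow> linked adj X \<longrightarrow> sum w P \<le> sum w X)"

definition nbhd :: "('a \<Rightarrow> 'a \<Rightarrow> bool) \<Rightarrow> 'a set \<Rightarrow> 'a set \<Rightarrow> 'a set" where
  "nbhd adj V P = {v \<in> V. v \<in> P \<or> (\<exists>p\<in>P. adj p v)}"

section \<open>Domination and retraction in an interval representation\<close>

locale interval_rep =
  fixes V :: "'a set" and adj :: "'a \<Rightarrow> 'a \<Rightarrow> bool" and L R :: "'a \<Rightarrow> real"
  assumes finite_V: "finite V"
    and L_le_R: "v \<in> V \<Longrightarrow> L v \<le> R v"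
    and adj_iff: "u \<in> V \<Longrightarrow> v \<in> V \<Longrightarrow> u \<noteq> v \<Longrightarrow> adj u v \<longleftrightarrow> L u \<le> R v \<and> L v \<le> R u"
    and adj_irrefl: "\<not> adj v v"
begin

text \<open>The set \<open>D\<close> of the overview.\<close>

definition between :: "'a \<Rightarrow> 'a \<Rightarrow> 'a set" where
  "between s t = {v \<in> V. R s \<le> R v \<and> L v \<le> L t}"

lemma overlap_imp: "u \<in> V \<Longrightarrow> v \<in> V \<Longrightarrow> L u \<le> R v \<Longrightarrow> L v \<le> R u \<Longrightarrow> u = v \<or> adj u v"
  using adj_iff by blast

text \<open>A discrete intermediate value argument: if no member contained \<open>z\<close>, those
  ending before \<open>z\<close> would form a closed subset of \<open>X\<close> with
  \<open>a\<close> but without \<open>b\<close>.\<close>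

lemma linked_crosses:
  assumes "linked adj X" "X \<subseteq> V" "a \<in> X" "b \<in> X" "L a \<le> z" "z \<le> R b"
  shows "\<exists>x\<in>X. L x \<le> z \<and> z \<le> R x"
proof (rule ccontr)
  assume *: "\<not> ?thesis"
  have "{v\<in>X. R v < z} = X"
  proof (rule linkedD[OF assms(1)])
    have "R a < z" using * assms(3,5) by (meson not_le)
    then show "{v\<in>X. R v < z} \<noteq> {}" using assms(3) by blast
    fix x y assume xy: "x \<in> {v\<in>X. R v < z}" "y \<in> X" "adj x y"
    then have "x \<in> V" "y \<in> V" "x \<noteq> y" using assms(2) adj_irrefl by auto
    then have "L y \<le> R x" using adj_iff xy(3) by blast
    then show "y \<in> {v\<in>X. R v < z}" using xy * by auto
  qed auto
  then have "b \<in> {v\<in>X. R v < z}" using assms by blast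
  then show False using assms by auto
qed

text \<open>If \<open>R s \<le> L t\<close>, the point \<open>max (L v) (R s)\<close> belongs to the
  interval of \<open>v\<close> and lies between \<open>R s\<close> and \<open>L t\<close>, so some
  member of \<open>P\<close> contains it by \<open>linked_crosses\<close>. Otherwise
  \<open>s\<close> itself meets \<open>v\<close>.\<close>

lemma between_subset_nbhd:
  assumes "linked adj P" "P \<subseteq> V" "s \<in> P" "t \<in> P" "s \<in> between s t"
  shows "between s t \<subseteq> nbhd adj V P"
proof
  fix v assume v: "v \<in> between s t"
  then have vV: "v \<in> V" by (simp add: between_def)
  have st: "L s \<le> R s" "L t \<le> R t" "L v \<le> R v" using L_le_R assms vV by auto
  have "\<exists>p\<in>P. L p \<le> R v \<and> L v \<le> R p"
  proof (cases "R s \<le> L t")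
    case True
    then obtain x where x: "x \<in> P" "L x \<le> max (L v) (R s)" "max (L v) (R s) \<le> R x"
      using st v assms linked_crosses[of P s t "max (L v) (R s)"]
      by (simp add: between_def max.coboundedI2) blast
    then show ?thesis using v st by (intro bexI[of _ x]) (auto simp: between_def)
  next
    case False
    then show ?thesis using v st assms(3) by (intro bexI[of _ s]) (auto simp: between_def)
  qed
  then show "v \<in> nbhd adj V P" using vV assms(2) adj_iff unfolding nbhd_def by blast
qed

text \<open>The vertices of \<open>P\<close> that end left of \<open>s\<close> can be retracted onto \<open>s\<close>, and those that begin
  right of \<open>t\<close> onto \<open>t\<close>; minimality leaves no such vertices.\<close>

lemma least_linked_subset_between:
  assumes P: "least_linked adj V w s t P" and w: "\<And>v. v \<in> V \<Longrightarrow> 0 < w v"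
    and st: "s \<in> between s t" "t \<in> between s t"
  shows "P \<subseteq> between s t"
proof
  fix v assume v: "v \<in> P"
  have PV: "P \<subseteq> V" "finite P" "s \<in> P" "t \<in> P" "linked adj P"
    using P finite_V finite_subset by (auto simp: least_linked_def)
  \<comment> \<open>Positive weights make every proper subset strictly lighter, so no linked one can
    still contain \<open>s\<close> and \<open>t\<close>.\<close>
  have proper: False if Q: "Q \<subset> P" "s \<in> Q" "t \<in> Q" "linked adj Q" for Q
  proof -
    have "sum w Q < sum w P"
    proof -
      obtain x where "x \<in> P - Q" using Q(1) by blast
      then show ?thesis
        using Q PV w[of x] by (intro sum_strict_mono2[of P Q x]) auto
    qed
    moreover have "sum w P \<le> sum w Q"
      using P Q PV unfolding least_linked_def by (meson order_trans psubset_imp_subset)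
    ultimately show False by simp
  qed
  have "R s \<le> R v"
  proof (rule ccontr)
    assume "\<not> R s \<le> R v"
    \<comment> \<open>If \<open>x\<close> is retracted and its neighbor \<open>y\<close> is not,
      then \<open>L y \<le> R x < R s \<le> R y\<close>, so \<open>y\<close> meets \<open>s\<close>
      at the point \<open>R s\<close>. The vertex \<open>t\<close> stays fixed because
      \<open>R s \<le> R t\<close>.\<close>
    let ?f = "\<lambda>v. if R v < R s then s else v"
    have "linked adj (?f ` P)"
    proof (rule linked_image[OF PV(5)])
      fix x y assume xy: "x \<in> P" "y \<in> P" "adj x y"
      then have "x \<in> V" "y \<in> V" "x \<noteq> y" "s \<in> V" using PV adj_irrefl by auto
      moreover from this have "L x \<le> R y" "L y \<le> R x" using adj_iff xy by blast+
      ultimately show "?f x = ?f y \<or> adj (?f x) (?f y)"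
        using overlap_imp[of s y] overlap_imp[of x s] L_le_R[of s] xy by (smt (verit))
    qed
    moreover have "v \<in> P - ?f ` P" "?f ` P \<subseteq> P" using v \<open>\<not> R s \<le> R v\<close> PV by auto
    moreover have "s \<in> ?f ` P" "t \<in> ?f ` P"
      using PV st image_eqI[of s ?f s P] image_eqI[of t ?f t P] by (auto simp: between_def)
    ultimately show False using proper[of "?f ` P"] by blast
  qed
  moreover have "L v \<le> L t"
  proof (rule ccontr)
    assume "\<not> L v \<le> L t"
    let ?f = "\<lambda>v. if L t < L v then t else v"
    have "linked adj (?f ` P)"
    proof (rule linked_image[OF PV(5)])
      fix x y assume xy: "x \<in> P" "y \<in> P" "adj x y"
      then have "x \<in> V" "y \<in> V" "x \<noteq> y" "t \<in> V" using PV adj_irrefl by auto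
      moreover from this have "L x \<le> R y" "L y \<le> R x" using adj_iff xy by blast+
      ultimately show "?f x = ?f y \<or> adj (?f x) (?f y)"
        using overlap_imp[of t y] overlap_imp[of x t] L_le_R[of t] xy by (smt (verit))
    qed
    moreover have "v \<in> P - ?f ` P" "?f ` P \<subseteq> P" using v \<open>\<not> L v \<le> L t\<close> PV by auto
    moreover have "s \<in> ?f ` P" "t \<in> ?f ` P"
      using PV st image_eqI[of s ?f s P] image_eqI[of t ?f t P] by (auto simp: between_def)
    ultimately show False using proper[of "?f ` P"] by blast
  qed
  ultimately show "v \<in> between s t" using v PV by (auto simp: between_def)
qed

end

section \<open>Color-favoring weights and the optimality bound\<close>

definition weight :: "nat \<Rightarrow> 'a set \<Rightarrow> 'a \<Rightarrow> nat" where
  "weight n F v = (if v \<in> F then Suc n else 1)"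

lemma sum_weight:
  assumes "finite P"
  shows "sum (weight n F) P = Suc n * card (P \<inter> F) + card (P - F)"
proof -
  have "sum (weight n F) P = sum (weight n F) (P \<inter> F) + sum (weight n F) (P - F)"
    by (subst sum.union_disjoint[symmetric]) (use assms in \<open>auto intro: arg_cong2[where f = sum]\<close>)
  then show ?thesis by (simp add: weight_def)
qed

text \<open>If some balanced set lies between \<open>P\<close> and its closed neighborhood, then the largest such set has
  \<open>2 * c\<close> vertices.\<close>

definition served :: "('a \<Rightarrow> 'a \<Rightarrow> bool) \<Rightarrow> 'a set \<Rightarrow> 'a set \<Rightarrow> nat \<Rightarrow> 'a set \<Rightarrow> bool" where
  "served adj V B k P \<longleftrightarrow>
     (let N = nbhd adj V P; c = min (card (N \<inter> B)) (card (N - B))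
      in max (card (P \<inter> B)) (card (P - B)) \<le> c \<longrightarrow> c \<le> k)"

text \<open>The set \<open>X\<close> only expresses that \<open>t\<close> lies in the connected
  component of \<open>s\<close>; for any other \<open>t\<close> there is no candidate
  \<open>P\<close>.\<close>

definition all_served :: "('a \<Rightarrow> 'a \<Rightarrow> bool) \<Rightarrow> 'a set \<Rightarrow> 'a set \<Rightarrow> ('a \<Rightarrow> nat) \<Rightarrow> 'a \<Rightarrow> nat \<Rightarrow> bool" where
  "all_served adj V B w s k \<longleftrightarrow>
     (\<forall>t X. X \<subseteq> V \<longrightarrow> s \<in> X \<longrightarrow> t \<in> X \<longrightarrow> linked adj X \<longrightarrow>
        (\<exists>P. least_linked adj V w s t P \<and> served adj V B k P))"

lemma (in interval_rep) balanced_linked_bound: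
  assumes B: "\<And>s. s \<in> V \<Longrightarrow> all_served adj V B (weight (card V) B) s k"
    and R: "\<And>s. s \<in> V \<Longrightarrow> all_served adj V B (weight (card V) (V - B)) s k"
    and W: "W \<subseteq> V" "linked adj W" "card (W \<inter> B) = card (W - B)"
  shows "card (W \<inter> B) \<le> k"
proof (cases "W = {}")
  case False
  let ?n = "card V"
  have fin: "finite W" using W finite_V finite_subset by auto
  define s where "s = arg_min_on R W"
  define t where "t = arg_min_on (\<lambda>v. - L v) W"
  have st: "s \<in> W" "t \<in> W"
    using fin False arg_min_if_finite(1) unfolding s_def t_def by auto
  have WD: "W \<subseteq> between s t"
  proof
    fix v assume v: "v \<in> W"
    then have "R s \<le> R v" "- L t \<le> - L v"
      using arg_min_least[OF fin False v, of R] arg_min_least[OF fin False v, of "\<lambda>v. - L v"]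
      unfolding s_def t_def by simp_all
    then show "v \<in> between s t" using v W by (auto simp: between_def)
  qed
  then have stD: "s \<in> between s t" "t \<in> between s t" using st by auto
  have card_V: "card (W \<inter> B) \<le> ?n" "card (W - B) \<le> ?n"
    using W finite_V by (auto intro!: card_mono)
  \<comment> \<open>At most \<open>card V\<close> vertices of \<open>W\<close> lie outside
    \<open>F\<close>, so the weight of \<open>W\<close> stays below
    \<open>Suc ?n * Suc (card (W \<inter> B))\<close>. This fixes the weight \<open>Suc ?n\<close>
    of the favored color.\<close>
  have favored: "card (P \<inter> F) \<le> card (W \<inter> B)"
    if P: "least_linked adj V (weight ?n F) s t P" and F: "F = B \<or> F = V - B" for P F
  proof -
    have "W \<inter> (V - B) = W - B" "W - (V - B) = W \<inter> B" using W by auto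
    then have WF: "card (W \<inter> F) = card (W \<inter> B)" "card (W - F) = card (W \<inter> B)" using F W(3) by auto
    have "finite P" using P finite_V finite_subset by (auto simp: least_linked_def)
    then have "Suc ?n * card (P \<inter> F) \<le> sum (weight ?n F) P" by (simp add: sum_weight)
    also have "\<dots> \<le> sum (weight ?n F) W"
      using P W st by (simp add: least_linked_def)
    also have "\<dots> < Suc ?n * Suc (card (W \<inter> B))"
      using card_V WF by (simp add: sum_weight[OF fin])
    finally show ?thesis by (metis mult_less_cancel1 less_Suc_eq_le)
  qed
  let ?D = "between s t"
  have finD: "finite ?D" using finite_V by (simp add: between_def)
  have WDB: "card (W \<inter> B) \<le> card (?D \<inter> B)" "card (W - B) \<le> card (?D - B)"
    using WD finD by (auto intro!: card_mono)
  \<comment> \<open>The smaller color count of \<open>?D\<close> is at least that of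
    \<open>W\<close> and at most that of the closed neighborhood of \<open>P\<close>. As
    \<open>P\<close> fits below it, \<open>served\<close> bounds all of them by
    \<open>k\<close>.\<close>
  have main: "card (W \<inter> B) \<le> k"
    if P: "least_linked adj V (weight ?n F) s t P" "served adj V B k P"
      and fit: "max (card (P \<inter> B)) (card (P - B)) \<le> min (card (?D \<inter> B)) (card (?D - B))" for P F
  proof -
    have "?D \<subseteq> nbhd adj V P"
      using between_subset_nbhd[of P s t] P stD by (auto simp: least_linked_def)
    moreover have "finite (nbhd adj V P)" using finite_V by (simp add: nbhd_def)
    ultimately have "card (?D \<inter> B) \<le> card (nbhd adj V P \<inter> B)" "card (?D - B) \<le> card (nbhd adj V P - B)"
      by (auto intro!: card_mono)
    then show ?thesis using P(2) fit WDB W(3) unfolding served_def Let_def by linarith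
  qed
  have inD: "card (P \<inter> B) \<le> card (?D \<inter> B)" "card (P - B) \<le> card (?D - B)"
    if "least_linked adj V (weight ?n F) s t P" for P F
  proof -
    have "P \<subseteq> ?D"
      by (rule least_linked_subset_between[OF that _ stD]) (simp add: weight_def)
    then show "card (P \<inter> B) \<le> card (?D \<inter> B)" "card (P - B) \<le> card (?D - B)"
      using finD by (auto intro!: card_mono)
  qed
  show ?thesis
  \<comment> \<open>The favored color is one that is at least as frequent in \<open>?D\<close> as
    the other. In it \<open>favored\<close> bounds \<open>P\<close>, and in the other color
    \<open>inD\<close> does.\<close>
  proof (cases "card (?D - B) \<le> card (?D \<inter> B)")
    case True
    obtain P where P: "least_linked adj V (weight ?n B) s t P" "served adj V B k P"
      using B[of s] st W unfolding all_served_def by blast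
    then show ?thesis using main[OF P] favored[OF P(1)] inD[OF P(1)] True WDB W(3) by simp
  next
    case False
    obtain P where P: "least_linked adj V (weight ?n (V - B)) s t P" "served adj V B k P"
      using R[of s] st W unfolding all_served_def by blast
    moreover have "P \<inter> (V - B) = P - B" using P(1) by (auto simp: least_linked_def)
    ultimately show ?thesis using main[OF P] favored[OF P(1)] inD[OF P(1)] False WDB W(3) by simp
  qed
qed simp

section \<open>The algorithm\<close>

lemma card_less_Suc_Collect:
  "card {v. v < Suc i \<and> Q v} = card {v. v < i \<and> Q v} + (if Q i then 1 else 0)"
proof (cases "Q i")
  case True
  then have "{v. v < Suc i \<and> Q v} = insert i {v. v < i \<and> Q v}" by (auto simp: less_Suc_eq)
  then show ?thesis using True by simp
next
  case False
  then have "{v. v < Suc i \<and> Q v} = {v. v < i \<and> Q v}" by (auto simp: less_Suc_eq)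
  then show ?thesis using False by simp
qed

section \<open>The program and its data layout\<close>

abbreviation (input) colA :: nat where "colA \<equiv> 0"
abbreviation (input) adjA :: nat where "adjA \<equiv> 9"
abbreviation (input) rowA :: nat where "rowA \<equiv> 2"
abbreviation (input) wtA :: nat where "wtA \<equiv> 3"
abbreviation (input) distA :: nat where "distA \<equiv> 4"
abbreviation (input) doneA :: nat where "doneA \<equiv> 5"
abbreviation (input) parA :: nat where "parA \<equiv> 6"
abbreviation (input) markA :: nat where "markA \<equiv> 7"
abbreviation (input) outA :: nat where "outA \<equiv> 8"

abbreviation (input) nV :: nat where "nV \<equiv> 0"
abbreviation (input) sV :: nat where "sV \<equiv> 2"
abbreviation (input) roundV :: nat where "roundV \<equiv> 3"
abbreviation (input) uV :: nat where "uV \<equiv> 4"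
abbreviation (input) vV :: nat where "vV \<equiv> 5"
abbreviation (input) minV :: nat where "minV \<equiv> 6"
abbreviation (input) parRowV :: nat where "parRowV \<equiv> 7"
abbreviation (input) rowV :: nat where "rowV \<equiv> 8"
abbreviation (input) coverBV :: nat where "coverBV \<equiv> 9"
abbreviation (input) coverRV :: nat where "coverRV \<equiv> 10"
abbreviation (input) pathBV :: nat where "pathBV \<equiv> 11"
abbreviation (input) pathRV :: nat where "pathRV \<equiv> 12"
abbreviation (input) sizeV :: nat where "sizeV \<equiv> 13"
abbreviation (input) bestV :: nat where "bestV \<equiv> 14"
abbreviation (input) needBV :: nat where "needBV \<equiv> 15"
abbreviation (input) needRV :: nat where "needRV \<equiv> 16"
abbreviation (input) markV :: nat where "markV \<equiv> 17"
abbreviation (input) baseV :: nat where "baseV \<equiv> 18"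
abbreviation (input) inV :: nat where "inV \<equiv> 19"

text \<open>Numbers serve as truth values, positive meaning true. Under truncated subtraction,
  \<open>b - a\<close> is positive exactly if \<open>a < b\<close>.\<close>

abbreviation (input) Or :: "exp \<Rightarrow> exp \<Rightarrow> exp" where "Or \<equiv> Plus"
abbreviation (input) Less :: "exp \<Rightarrow> exp \<Rightarrow> exp" where "Less a b \<equiv> Minus b a"
abbreviation (input) Zero :: "exp \<Rightarrow> exp" where "Zero a \<equiv> Minus (Num 1) a"
abbreviation (input) Incr :: "nat \<Rightarrow> com" where "Incr x \<equiv> Assign x (Plus (Var x) (Num 1))"
abbreviation (input) Decr :: "nat \<Rightarrow> com" where "Decr x \<equiv> Assign x (Minus (Var x) (Num 1))"
abbreviation (input) When :: "exp \<Rightarrow> com \<Rightarrow> com" where "When e c \<equiv> Cond e c Skip"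
abbreviation (input) Unless :: "exp \<Rightarrow> com \<Rightarrow> com" where "Unless e c \<equiv> Cond e Skip c"
abbreviation (input) At :: "nat \<Rightarrow> exp" where "At a \<equiv> Arr a (Var vV)"
abbreviation (input) InRow :: "nat \<Rightarrow> nat \<Rightarrow> exp" where "InRow a r \<equiv> Arr a (Plus (Var r) (Var vV))"

text \<open>Distance \<open>0\<close> means that a vertex has not been reached; true distances are positive. In row \<open>u\<close> of
  \<open>markA\<close>, an entry \<open>2\<close> marks a vertex of the lightest connected set found for \<open>u\<close>, and an entry
  \<open>1\<close> one of its other neighbors.\<close>

definition find_min :: com where
  "find_min = For vV (When (At distA) (Unless (At doneA)
     (When (Or (Less (At distA) (Var minV)) (Zero (Var minV)))
        (Assign minV (At distA) ;; Assign uV (Var vV)))))"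

text \<open>The guard of the last assignment tests for \<open>v = u\<close>. This assignment comes
  last because \<open>u\<close>, as a neighbor of its parent, already has a positive mark in the row
  of the parent. Marks \<open>2\<close> are inherited, and so is the parent's set.\<close>

definition mark_step :: com where
  "mark_step =
     Assign markV (InRow markA parRowV) ;;
     Unless (Var markV) (Assign markV (InRow adjA rowV)) ;;
     Unless (Or (Less (Var vV) (Var uV)) (Less (Var uV) (Var vV))) (Assign markV (Num 2))"

definition cover_step :: com where
  "cover_step =
     mark_step ;;
     Update markA (Plus (Var rowV) (Var vV)) (Var markV) ;;
     When (Var markV) (Cond (At colA)
       (Incr coverBV ;; When (Less (Num 1) (Var markV)) (Incr pathBV))
       (Incr coverRV ;; When (Less (Num 1) (Var markV)) (Incr pathRV)))"

definition cover :: com where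
  "cover = For vV cover_step"

text \<open>A greedy choice suffices: every set between \<open>P\<close> and its closed neighborhood
  is linked, so only the number of added vertices of each color matters.\<close>

definition fill_step :: com where
  "fill_step =
     Update outA (Var vV) (Num 0) ;;
     Cond (Less (Num 1) (InRow markA rowV))
       (Update outA (Var vV) (Num 1))
       (When (InRow markA rowV) (Cond (At colA)
         (When (Var needBV) (Decr needBV ;; Update outA (Var vV) (Num 1)))
         (When (Var needRV) (Decr needRV ;; Update outA (Var vV) (Num 1)))))"

definition fill :: com where
  "fill = For vV fill_step"

text \<open>Under truncated subtraction \<open>a - (a - b)\<close> is a minimum. Writing out the set
  by \<open>fill\<close> takes linear time, which is affordable even at every settled
  vertex.\<close>

definition improve :: com where
  "improve =
     Assign sizeV (Minus (Var coverBV) (Minus (Var coverBV) (Var coverRV))) ;;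
     When (Less (Var bestV) (Var sizeV))
       (Unless (Or (Less (Var sizeV) (Var pathBV)) (Less (Var sizeV) (Var pathRV)))
         (Assign bestV (Var sizeV) ;;
          Assign needBV (Minus (Var sizeV) (Var pathBV)) ;;
          Assign needRV (Minus (Var sizeV) (Var pathRV)) ;;
          fill))"

definition relax_step :: com where
  "relax_step = When (InRow adjA rowV) (Unless (At doneA)
     (When (Or (Less (Plus (Var minV) (At wtA)) (At distA)) (Zero (At distA)))
       (Update distA (Var vV) (Plus (Var minV) (At wtA)) ;;
        Update parA (Var vV) (Var uV))))"

definition relax :: com where
  "relax = For vV relax_step"

definition settle :: com where
  "settle =
     Update doneA (Var uV) (Num 1) ;;
     Assign parRowV (Arr rowA (Arr parA (Var uV))) ;;
     Assign rowV (Arr rowA (Var uV)) ;;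
     Assign coverBV (Num 0) ;; Assign coverRV (Num 0) ;; Assign pathBV (Num 0) ;; Assign pathRV (Num 0) ;;
     cover"

definition search_round :: com where
  "search_round = Assign minV (Num 0) ;; find_min ;; When (Var minV) (settle ;; improve ;; relax)"

text \<open>Marks are not cleared between searches: a row is rewritten completely when its vertex is
  settled, and the rows consulted as parents belong to vertices settled in the same search or are
  row \<open>n\<close>.\<close>

definition search :: com where
  "search =
     For vV (Update distA (Var vV) (Num 0) ;; Update doneA (Var vV) (Num 0)) ;;
     Update distA (Var sV) (Arr wtA (Var sV)) ;;
     Update parA (Var sV) (Var nV) ;;
     For roundV search_round"

definition weights :: "exp \<Rightarrow> exp \<Rightarrow> com" where
  "weights b r = For vV (Cond (At colA) (Update wtA (Var vV) b) (Update wtA (Var vV) r))"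

text \<open>In the absence of multiplication, the row offsets \<open>u * n\<close> are tabulated by
  repeated addition. Entry \<open>n\<close> is included because \<open>n\<close> acts as the parent
  of the source.\<close>

definition read_graph :: com where
  "read_graph =
     For vV (Get inV ;; Update colA (Var vV) (Var inV)) ;;
     For sV (
       Update rowA (Var sV) (Var baseV) ;;
       For vV (Get inV ;; Update adjA (Plus (Var baseV) (Var vV)) (Var inV)) ;;
       Assign baseV (Plus (Var baseV) (Var nV))) ;;
     Update rowA (Var nV) (Var baseV)"

definition solve :: com where
  "solve =
     read_graph ;;
     weights (Plus (Var nV) (Num 1)) (Num 1) ;; For sV search ;;
     weights (Num 1) (Plus (Var nV) (Num 1)) ;; For sV search ;;
     For vV (When (At outA) (Put (Var vV)))"

lemmas program_defs = solve_def read_graph_def weights_def search_def search_round_def settle_def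
  relax_def relax_step_def improve_def fill_def fill_step_def cover_def cover_step_def mark_step_def find_min_def

lemma wf_solve: "wf_com solve"
  by (simp add: program_defs)

text \<open>The levels are source, round and vertex. This depth is the exponent of the running
  time.\<close>

lemma depth_solve: "depth solve = 3"
  by (simp add: program_defs)

section \<open>Effects of the individual loops\<close>

lemma frame_sets:
  "writes find_min = {minV, uV, vV}" "arr_writes find_min = {}"
  "writes cover = {markV, coverBV, coverRV, pathBV, pathRV, vV}" "arr_writes cover = {markA}"
  "writes fill = {needBV, needRV, vV}" "arr_writes fill = {outA}"
  "writes improve = {sizeV, bestV, needBV, needRV, vV}" "arr_writes improve = {outA}"
  "writes relax = {vV}" "arr_writes relax = {distA, parA}"
  "writes settle = {parRowV, rowV, markV, coverBV, coverRV, pathBV, pathRV, vV}"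
  "arr_writes settle = {doneA, markA}"
  by (auto simp: program_defs)

lemma counter_not_written [simp]:
  "vV \<notin> writes cover_step" "vV \<notin> writes fill_step" "vV \<notin> writes relax_step"
  "roundV \<notin> writes search_round" "sV \<notin> writes search"
  by (auto simp: program_defs)

lemma run_find_min:
  fixes \<sigma> defines "\<tau> \<equiv> run find_min \<sigma>"
  assumes "var \<sigma> minV = 0"
  shows "\<And>v. v < var \<sigma> nV \<Longrightarrow> arr \<sigma> distA v \<noteq> 0 \<Longrightarrow> arr \<sigma> doneA v = 0 \<Longrightarrow>
           0 < var \<tau> minV \<and> var \<tau> minV \<le> arr \<sigma> distA v"
    and "0 < var \<tau> minV \<Longrightarrow> var \<tau> uV < var \<sigma> nV \<and> arr \<sigma> distA (var \<tau> uV) = var \<tau> minV \<and>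
           arr \<sigma> doneA (var \<tau> uV) = 0"
proof -
  let ?I = "\<lambda>i \<tau>. (\<forall>v<i. arr \<sigma> distA v \<noteq> 0 \<longrightarrow> arr \<sigma> doneA v = 0 \<longrightarrow>
                     0 < var \<tau> minV \<and> var \<tau> minV \<le> arr \<sigma> distA v) \<and>
                  (0 < var \<tau> minV \<longrightarrow> var \<tau> uV < i \<and> arr \<sigma> distA (var \<tau> uV) = var \<tau> minV \<and>
                     arr \<sigma> doneA (var \<tau> uV) = 0)"
  have "?I (var \<sigma> 0) \<tau>"
    unfolding \<tau>_def find_min_def
  proof (rule For_invariant[where I = ?I], goal_cases)
    case (3 i \<tau>')
    then show ?case by (auto simp: frame_def less_Suc_eq)
  qed (use assms in auto)
  then show "\<And>v. v < var \<sigma> nV \<Longrightarrow> arr \<sigma> distA v \<noteq> 0 \<Longrightarrow> arr \<sigma> doneA v = 0 \<Longrightarrow>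
           0 < var \<tau> minV \<and> var \<tau> minV \<le> arr \<sigma> distA v"
    and "0 < var \<tau> minV \<Longrightarrow> var \<tau> uV < var \<sigma> nV \<and> arr \<sigma> distA (var \<tau> uV) = var \<tau> minV \<and>
           arr \<sigma> doneA (var \<tau> uV) = 0"
    by blast+
qed


lemma row_index_inject:
  "v < n \<Longrightarrow> v' < n \<Longrightarrow> p * n + v = u * n + v' \<longleftrightarrow> p = u \<and> v = v'" for n :: nat
proof
  assume n: "v < n" "v' < n" and eq: "p * n + v = u * n + v'"
  have "(p * n + v) div n = p" "(u * n + v') div n = u" using n by simp_all
  then show "p = u \<and> v = v'" using eq by simp
qed simp

lemma run_mark_step:
  "run mark_step \<sigma> = set_var markV
     (if var \<sigma> vV = var \<sigma> uV then 2
      else if 0 < arr \<sigma> markA (var \<sigma> parRowV + var \<sigma> vV) then arr \<sigma> markA (var \<sigma> parRowV + var \<sigma> vV)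
      else arr \<sigma> adjA (var \<sigma> rowV + var \<sigma> vV)) \<sigma>"
proof -
  have "0 < var \<sigma> uV - var \<sigma> vV + (var \<sigma> vV - var \<sigma> uV) \<longleftrightarrow> var \<sigma> vV \<noteq> var \<sigma> uV" by auto
  then show ?thesis by (simp add: mark_step_def set_var_def)
qed

lemma run_cover_step:
  fixes \<sigma> isB defines "\<tau> \<equiv> run cover_step \<sigma>"
    and "m \<equiv> (if var \<sigma> vV = var \<sigma> uV then 2
               else if 0 < arr \<sigma> markA (var \<sigma> parRowV + var \<sigma> vV) then arr \<sigma> markA (var \<sigma> parRowV + var \<sigma> vV)
               else arr \<sigma> adjA (var \<sigma> rowV + var \<sigma> vV))"
    and "isB \<equiv> 0 < arr \<sigma> colA (var \<sigma> vV)"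
  shows "arr \<tau> markA = (arr \<sigma> markA)(var \<sigma> rowV + var \<sigma> vV := m)"
    and "var \<tau> coverBV = var \<sigma> coverBV + (if 0 < m \<and> isB then 1 else 0)"
    and "var \<tau> coverRV = var \<sigma> coverRV + (if 0 < m \<and> \<not> isB then 1 else 0)"
    and "var \<tau> pathBV = var \<sigma> pathBV + (if 1 < m \<and> isB then 1 else 0)"
    and "var \<tau> pathRV = var \<sigma> pathRV + (if 1 < m \<and> \<not> isB then 1 else 0)"
proof -
  have "run cover_step \<sigma> = run (Update markA (Plus (Var rowV) (Var vV)) (Var markV) ;;
     When (Var markV) (Cond (At colA)
       (Incr coverBV ;; When (Less (Num 1) (Var markV)) (Incr pathBV))
       (Incr coverRV ;; When (Less (Num 1) (Var markV)) (Incr pathRV)))) (set_var markV m \<sigma>)"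
    by (simp add: cover_step_def run_mark_step m_def)
  then show "arr \<tau> markA = (arr \<sigma> markA)(var \<sigma> rowV + var \<sigma> vV := m)"
    and "var \<tau> coverBV = var \<sigma> coverBV + (if 0 < m \<and> isB then 1 else 0)"
    and "var \<tau> coverRV = var \<sigma> coverRV + (if 0 < m \<and> \<not> isB then 1 else 0)"
    and "var \<tau> pathBV = var \<sigma> pathBV + (if 1 < m \<and> isB then 1 else 0)"
    and "var \<tau> pathRV = var \<sigma> pathRV + (if 1 < m \<and> \<not> isB then 1 else 0)"
    by (simp_all add: \<tau>_def isB_def fun_eq_iff)
qed

text \<open>The loop reads row \<open>p\<close> while it writes row \<open>u\<close>. These are
  disjoint by \<open>p \<noteq> u\<close> and \<open>row_index_inject\<close>, so the new marks can
  be expressed by the initial state.\<close>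

lemma run_cover:
  fixes \<sigma> n u p
  defines "\<tau> \<equiv> run cover \<sigma>"
    and "mark \<equiv> (\<lambda>v. if v = u then 2 else if 0 < arr \<sigma> markA (p * n + v) then arr \<sigma> markA (p * n + v)
                    else arr \<sigma> adjA (u * n + v))"
  assumes "var \<sigma> nV = n" "var \<sigma> uV = u" "var \<sigma> rowV = u * n" "var \<sigma> parRowV = p * n" "p \<noteq> u"
    and "var \<sigma> coverBV = 0" "var \<sigma> coverRV = 0" "var \<sigma> pathBV = 0" "var \<sigma> pathRV = 0"
  shows "\<forall>v<n. arr \<tau> markA (u * n + v) = mark v"
    and "\<forall>j. (\<forall>v<n. j \<noteq> u * n + v) \<longrightarrow> arr \<tau> markA j = arr \<sigma> markA j"
    and "var \<tau> coverBV = card {v. v < n \<and> 0 < mark v \<and> 0 < arr \<sigma> colA v}"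
    and "var \<tau> coverRV = card {v. v < n \<and> 0 < mark v \<and> \<not> 0 < arr \<sigma> colA v}"
    and "var \<tau> pathBV = card {v. v < n \<and> 1 < mark v \<and> 0 < arr \<sigma> colA v}"
    and "var \<tau> pathRV = card {v. v < n \<and> 1 < mark v \<and> \<not> 0 < arr \<sigma> colA v}"
proof -
  let ?I = "\<lambda>i \<tau>. (\<forall>v<i. arr \<tau> markA (u * n + v) = mark v) \<and>
    (\<forall>j. (\<forall>v<i. j \<noteq> u * n + v) \<longrightarrow> arr \<tau> markA j = arr \<sigma> markA j) \<and>
    var \<tau> coverBV = card {v. v < i \<and> 0 < mark v \<and> 0 < arr \<sigma> colA v} \<and>
    var \<tau> coverRV = card {v. v < i \<and> 0 < mark v \<and> \<not> 0 < arr \<sigma> colA v} \<and>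
    var \<tau> pathBV = card {v. v < i \<and> 1 < mark v \<and> 0 < arr \<sigma> colA v} \<and>
    var \<tau> pathRV = card {v. v < i \<and> 1 < mark v \<and> \<not> 0 < arr \<sigma> colA v}"
  have "?I (var \<sigma> 0) \<tau>"
    unfolding \<tau>_def cover_def
  proof (rule For_invariant[where I = ?I], goal_cases)
    case (3 i \<tau>')
    then have i: "i < n" using assms by simp
    have "\<forall>v<i. p * n + i \<noteq> u * n + v"
      using i \<open>p \<noteq> u\<close> row_index_inject[of i n] by auto
    then have par: "arr \<tau>' markA (p * n + i) = arr \<sigma> markA (p * n + i)" using 3 by blast
    have fr: "arr \<tau>' colA = arr \<sigma> colA" "arr \<tau>' adjA = arr \<sigma> adjA" "var \<tau>' uV = u"
        "var \<tau>' rowV = u * n" "var \<tau>' parRowV = p * n"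
      using 3(4) assms by (simp_all add: frame_def program_defs)
    have m: "(if i = u then 2 else if 0 < arr \<sigma> markA (p * n + i) then arr \<sigma> markA (p * n + i)
                    else arr \<sigma> adjA (u * n + i)) = mark i" by (simp add: mark_def)
    note step = run_cover_step[of \<tau>', unfolded 3(3) fr par m]
    show ?case
      unfolding card_less_Suc_Collect using 3(2) by (simp add: step less_Suc_eq)
  qed (use assms in auto)
  with assms show "\<forall>v<n. arr \<tau> markA (u * n + v) = mark v"
    and "\<forall>j. (\<forall>v<n. j \<noteq> u * n + v) \<longrightarrow> arr \<tau> markA j = arr \<sigma> markA j"
    and "var \<tau> coverBV = card {v. v < n \<and> 0 < mark v \<and> 0 < arr \<sigma> colA v}"
    and "var \<tau> coverRV = card {v. v < n \<and> 0 < mark v \<and> \<not> 0 < arr \<sigma> colA v}"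
    and "var \<tau> pathBV = card {v. v < n \<and> 1 < mark v \<and> 0 < arr \<sigma> colA v}"
    and "var \<tau> pathRV = card {v. v < n \<and> 1 < mark v \<and> \<not> 0 < arr \<sigma> colA v}"
    by simp_all
qed

lemma run_fill_step:
  fixes \<sigma> isB defines "\<tau> \<equiv> run fill_step \<sigma>"
    and "m \<equiv> arr \<sigma> markA (var \<sigma> rowV + var \<sigma> vV)"
    and "isB \<equiv> 0 < arr \<sigma> colA (var \<sigma> vV)"
  shows "arr \<tau> outA = (arr \<sigma> outA)(var \<sigma> vV :=
           if 1 < m \<or> 0 < m \<and> (if isB then 0 < var \<sigma> needBV else 0 < var \<sigma> needRV) then 1 else 0)"
    and "var \<tau> needBV = var \<sigma> needBV - (if m = 1 \<and> isB then 1 else 0)"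
    and "var \<tau> needRV = var \<sigma> needRV - (if m = 1 \<and> \<not> isB then 1 else 0)"
  unfolding \<tau>_def fill_step_def m_def isB_def by (auto simp: fun_eq_iff)

text \<open>\<open>Q\<close> selects a color, \<open>d\<close> is the initial demand for vertices of this color off the path, and \<open>r\<close>
  the demand that remains after the vertices below \<open>i\<close>.\<close>

definition filled :: "(nat \<Rightarrow> nat) \<Rightarrow> (nat \<Rightarrow> bool) \<Rightarrow> nat \<Rightarrow> nat \<Rightarrow> (nat \<Rightarrow> nat) \<Rightarrow> nat \<Rightarrow> bool" where
  "filled mark Q d i out r \<longleftrightarrow>
     card {v. v < i \<and> 0 < out v \<and> Q v} + r = d + card {v. v < i \<and> 1 < mark v \<and> Q v} \<and>
     (0 < r \<longrightarrow> (\<forall>v<i. Q v \<longrightarrow> 0 < mark v \<longrightarrow> 0 < out v))"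

lemma filled_Suc:
  assumes "filled mark Q d i out r" "\<forall>v<i. out' v = out v"
    and "Q i \<Longrightarrow> 0 < out' i \<longleftrightarrow> 1 < mark i \<or> 0 < mark i \<and> 0 < r"
    and "r' = r - (if mark i = 1 \<and> Q i then 1 else 0)"
  shows "filled mark Q d (Suc i) out' r'"
proof -
  have *: "card {v. v < i \<and> 0 < out' v \<and> Q v} = card {v. v < i \<and> 0 < out v \<and> Q v}"
    using assms(2) by (intro arg_cong[where f = card]) auto
  have **: "(\<forall>v<i. Q v \<longrightarrow> 0 < mark v \<longrightarrow> 0 < out' v) = (\<forall>v<i. Q v \<longrightarrow> 0 < mark v \<longrightarrow> 0 < out v)"
    using assms(2) by simp
  consider "\<not> Q i" | "Q i" "mark i = 0" | "Q i" "mark i = 1" "r = 0" | "Q i" "mark i = 1" "0 < r" |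
      "Q i" "1 < mark i"
    by linarith
  then show ?thesis
    unfolding filled_def card_less_Suc_Collect All_less_Suc * **
    by cases (use assms(1,3,4) in \<open>auto simp: filled_def\<close>)
qed

text \<open>The count plus the remaining demand \<open>r\<close> is \<open>k\<close>. If
  \<open>r\<close> were positive, every marked vertex of the color would have been taken, and these
  are already at least \<open>k\<close>.\<close>

lemma filled_card:
  assumes "filled mark Q (k - card {v. v < n \<and> 1 < mark v \<and> Q v}) n out r"
    and "card {v. v < n \<and> 1 < mark v \<and> Q v} \<le> k" "k \<le> card {v. v < n \<and> 0 < mark v \<and> Q v}"
    and "\<forall>v<n. 0 < out v \<longrightarrow> 0 < mark v"
  shows "card {v. v < n \<and> 0 < out v \<and> Q v} = k"
proof (cases "r = 0")
  case False
  then have "{v. v < n \<and> 0 < out v \<and> Q v} = {v. v < n \<and> 0 < mark v \<and> Q v}"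
    using assms(1,4) by (auto simp: filled_def)
  then show ?thesis using assms False by (simp add: filled_def)
qed (use assms in \<open>simp add: filled_def\<close>)

lemma run_fill:
  fixes \<sigma> n k mark isB
  defines "\<tau> \<equiv> run fill \<sigma>"
    and "mark \<equiv> (\<lambda>v. arr \<sigma> markA (var \<sigma> rowV + v))"
    and "isB \<equiv> (\<lambda>v. 0 < arr \<sigma> colA v)"
  assumes "var \<sigma> nV = n"
    and "var \<sigma> needBV = k - card {v. v < n \<and> 1 < mark v \<and> isB v}"
    and "var \<sigma> needRV = k - card {v. v < n \<and> 1 < mark v \<and> \<not> isB v}"
    and "card {v. v < n \<and> 1 < mark v \<and> isB v} \<le> k" "k \<le> card {v. v < n \<and> 0 < mark v \<and> isB v}"
    and "card {v. v < n \<and> 1 < mark v \<and> \<not> isB v} \<le> k"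
      "k \<le> card {v. v < n \<and> 0 < mark v \<and> \<not> isB v}"
  shows "\<forall>v<n. (1 < mark v \<longrightarrow> 0 < arr \<tau> outA v) \<and> (0 < arr \<tau> outA v \<longrightarrow> 0 < mark v)"
    and "card {v. v < n \<and> 0 < arr \<tau> outA v \<and> isB v} = k"
    and "card {v. v < n \<and> 0 < arr \<tau> outA v \<and> \<not> isB v} = k"
proof -
  let ?I = "\<lambda>i \<tau>. (\<forall>v<i. (1 < mark v \<longrightarrow> 0 < arr \<tau> outA v) \<and> (0 < arr \<tau> outA v \<longrightarrow> 0 < mark v)) \<and>
    filled mark isB (var \<sigma> needBV) i (arr \<tau> outA) (var \<tau> needBV) \<and>
    filled mark (\<lambda>v. \<not> isB v) (var \<sigma> needRV) i (arr \<tau> outA) (var \<tau> needRV)"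
  have "?I (var \<sigma> 0) \<tau>"
    unfolding \<tau>_def fill_def
  proof (rule For_invariant[where I = ?I], goal_cases)
    case (3 i \<tau>')
    have fr: "arr \<tau>' colA = arr \<sigma> colA" "arr \<tau>' markA = arr \<sigma> markA" "var \<tau>' rowV = var \<sigma> rowV"
      using 3(4) assms by (simp_all add: frame_def program_defs)
    have bi: "0 < arr \<sigma> colA i \<longleftrightarrow> isB i" "arr \<sigma> markA (var \<sigma> rowV + i) = mark i"
      by (simp_all add: isB_def mark_def)
    note step = run_fill_step[of \<tau>', unfolded 3(3) fr bi]
    let ?\<tau> = "run fill_step \<tau>'"
    have "filled mark isB (var \<sigma> needBV) (Suc i) (arr ?\<tau> outA) (var ?\<tau> needBV)"
      by (rule filled_Suc[of _ _ _ _ "arr \<tau>' outA" "var \<tau>' needBV"]) (use 3(2) in \<open>auto simp: step\<close>)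
    moreover have "filled mark (\<lambda>v. \<not> isB v) (var \<sigma> needRV) (Suc i) (arr ?\<tau> outA) (var ?\<tau> needRV)"
      by (rule filled_Suc[of _ _ _ _ "arr \<tau>' outA" "var \<tau>' needRV"]) (use 3(2) in \<open>auto simp: step\<close>)
    ultimately show ?case
      using 3(2) by (simp add: step(1) All_less_Suc)
  qed (use assms in \<open>auto simp: filled_def\<close>)
  then have I: "?I n \<tau>" using assms(4) by simp
  then show "\<forall>v<n. (1 < mark v \<longrightarrow> 0 < arr \<tau> outA v) \<and> (0 < arr \<tau> outA v \<longrightarrow> 0 < mark v)" by blast
  show "card {v. v < n \<and> 0 < arr \<tau> outA v \<and> isB v} = k"
    by (rule filled_card[of mark]) (use I assms(5,7,8) in auto)
  show "card {v. v < n \<and> 0 < arr \<tau> outA v \<and> \<not> isB v} = k"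
    by (rule filled_card[of mark]) (use I assms(6,9,10) in auto)
qed

lemma run_relax_step:
  fixes \<sigma> v defines "\<tau> \<equiv> run relax_step \<sigma>" and "v \<equiv> var \<sigma> vV"
    and "upd \<equiv> 0 < arr \<sigma> adjA (var \<sigma> rowV + v) \<and> arr \<sigma> doneA v = 0 \<and>
          (arr \<sigma> distA v = 0 \<or> var \<sigma> minV + arr \<sigma> wtA v < arr \<sigma> distA v)"
  shows "arr \<tau> distA = (arr \<sigma> distA)(v := if upd then var \<sigma> minV + arr \<sigma> wtA v else arr \<sigma> distA v)"
    and "arr \<tau> parA = (arr \<sigma> parA)(v := if upd then var \<sigma> uV else arr \<sigma> parA v)"
  unfolding \<tau>_def relax_step_def v_def upd_def by (auto simp: fun_eq_iff)

lemma run_relax: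
  fixes \<sigma> n u
  defines "\<tau> \<equiv> run relax \<sigma>"
    and "upd \<equiv> (\<lambda>v. v < var \<sigma> nV \<and> 0 < arr \<sigma> adjA (var \<sigma> rowV + v) \<and> arr \<sigma> doneA v = 0 \<and>
          (arr \<sigma> distA v = 0 \<or> var \<sigma> minV + arr \<sigma> wtA v < arr \<sigma> distA v))"
  shows "arr \<tau> distA = (\<lambda>v. if upd v then var \<sigma> minV + arr \<sigma> wtA v else arr \<sigma> distA v)"
    and "arr \<tau> parA = (\<lambda>v. if upd v then var \<sigma> uV else arr \<sigma> parA v)"
proof -
  let ?I = "\<lambda>i \<tau>.
    (\<forall>v. arr \<tau> distA v = (if v < i \<and> upd v then var \<sigma> minV + arr \<sigma> wtA v else arr \<sigma> distA v)) \<and>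
    (\<forall>v. arr \<tau> parA v = (if v < i \<and> upd v then var \<sigma> uV else arr \<sigma> parA v))"
  have "?I (var \<sigma> 0) \<tau>"
    unfolding \<tau>_def relax_def
  proof (rule For_invariant[where I = ?I], goal_cases)
    case (3 i \<tau>')
    have fr: "arr \<tau>' adjA = arr \<sigma> adjA" "arr \<tau>' doneA = arr \<sigma> doneA" "arr \<tau>' wtA = arr \<sigma> wtA"
        "var \<tau>' rowV = var \<sigma> rowV" "var \<tau>' minV = var \<sigma> minV" "var \<tau>' uV = var \<sigma> uV"
      using 3(4) by (simp_all add: frame_def program_defs)
    note step = run_relax_step[of \<tau>', unfolded 3(3) fr]
    have old: "arr \<tau>' distA i = arr \<sigma> distA i" "arr \<tau>' parA i = arr \<sigma> parA i" using 3(2) by auto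
    have "upd i \<longleftrightarrow> 0 < arr \<sigma> adjA (var \<sigma> rowV + i) \<and> arr \<sigma> doneA i = 0 \<and>
          (arr \<sigma> distA i = 0 \<or> var \<sigma> minV + arr \<sigma> wtA i < arr \<sigma> distA i)"
      using 3(1) by (simp add: upd_def)
    note step = step[unfolded old this[symmetric]]
    show ?case using 3(2) by (auto simp: step less_Suc_eq)
  qed auto
  then show "arr \<tau> distA = (\<lambda>v. if upd v then var \<sigma> minV + arr \<sigma> wtA v else arr \<sigma> distA v)"
    and "arr \<tau> parA = (\<lambda>v. if upd v then var \<sigma> uV else arr \<sigma> parA v)"
    by (auto simp: fun_eq_iff upd_def)
qed


lemma frame_settle:
  "x \<notin> {parRowV, rowV, markV, coverBV, coverRV, pathBV, pathRV, vV} \<Longrightarrow> var (run settle \<sigma>) x = var \<sigma> x"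
  "a \<notin> {doneA, markA} \<Longrightarrow> arr (run settle \<sigma>) a = arr \<sigma> a"
  by (rule run_frame; simp add: frame_sets)+

lemma frame_improve:
  "x \<notin> {sizeV, bestV, needBV, needRV, vV} \<Longrightarrow> var (run improve \<sigma>) x = var \<sigma> x"
  "a \<notin> {outA} \<Longrightarrow> arr (run improve \<sigma>) a = arr \<sigma> a"
  by (rule run_frame; simp add: frame_sets)+

lemma frame_relax:
  "x \<noteq> vV \<Longrightarrow> var (run relax \<sigma>) x = var \<sigma> x"
  "a \<notin> {distA, parA} \<Longrightarrow> arr (run relax \<sigma>) a = arr \<sigma> a"
  by (rule run_frame; simp add: frame_sets)+

lemma frame_find_min:
  "x \<notin> {minV, uV, vV} \<Longrightarrow> var (run find_min \<sigma>) x = var \<sigma> x"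
  "arr (run find_min \<sigma>) a = arr \<sigma> a"
  by (rule run_frame; simp add: frame_sets)+

section \<open>The invariant of the search from one source\<close>

locale bcs_instance =
  fixes n :: nat and adj :: "nat \<Rightarrow> nat \<Rightarrow> bool" and B :: "nat set"
  assumes symp_adj: "symp adj"
begin

abbreviation V :: "nat set" where "V \<equiv> {..<n}"

definition graph_loaded :: "state \<Rightarrow> bool" where
  "graph_loaded \<sigma> \<longleftrightarrow> var \<sigma> nV = n \<and> (\<forall>v<n. 0 < arr \<sigma> colA v \<longleftrightarrow> v \<in> B) \<and>
     (\<forall>u<n. \<forall>v<n. arr \<sigma> adjA (u * n + v) = (if adj u v then 1 else 0)) \<and>
     (\<forall>u\<le>n. arr \<sigma> rowA u = u * n)"

definition marked :: "state \<Rightarrow> nat \<Rightarrow> nat set" where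
  "marked \<sigma> u = {v. v < n \<and> 1 < arr \<sigma> markA (u * n + v)}"

text \<open>Row \<open>n\<close> of the array of marks stays zero and serves as the row of the parent of the source.\<close>

definition rows_ok :: "state \<Rightarrow> bool" where
  "rows_ok \<sigma> \<longleftrightarrow> (\<forall>v<n. arr \<sigma> markA (n * n + v) = 0)"

definition best_ok :: "state \<Rightarrow> bool" where
  "best_ok \<sigma> \<longleftrightarrow> (let W = {v. v < n \<and> 0 < arr \<sigma> outA v} in
     linked adj W \<and> card (W \<inter> B) = var \<sigma> bestV \<and> card (W - B) = var \<sigma> bestV)"

definition settled_ok :: "state \<Rightarrow> (nat \<Rightarrow> nat) \<Rightarrow> nat \<Rightarrow> nat \<Rightarrow> bool" where
  "settled_ok \<sigma> w s u \<longleftrightarrow>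
     least_linked adj V w s u (marked \<sigma> u) \<and> sum w (marked \<sigma> u) = arr \<sigma> distA u \<and>
     (\<forall>v<n. arr \<sigma> markA (u * n + v) \<le> 2) \<and>
     {v. v < n \<and> 0 < arr \<sigma> markA (u * n + v)} = nbhd adj V (marked \<sigma> u) \<and>
     served adj V B (var \<sigma> bestV) (marked \<sigma> u)"

definition settled :: "state \<Rightarrow> nat set" where
  "settled \<sigma> = {v. v < n \<and> arr \<sigma> doneA v \<noteq> 0}"

text \<open>Settled vertices have exact distances by \<open>settled_ok\<close>. For other vertices,
  a nonzero distance is attained through a settled parent, whose row of marks is therefore
  available, and is at most what any settled neighbor offers. Before the first round only
  \<open>s\<close> is reached, with the artificial parent \<open>n\<close>.\<close>

definition dijkstra :: "state \<Rightarrow> (nat \<Rightarrow> nat) \<Rightarrow> nat \<Rightarrow> bool" where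
  "dijkstra \<sigma> w s \<longleftrightarrow> (let S = settled \<sigma>; d = arr \<sigma> distA; p = arr \<sigma> parA in
     graph_loaded \<sigma> \<and> rows_ok \<sigma> \<and> best_ok \<sigma> \<and> (\<forall>v<n. arr \<sigma> wtA v = w v) \<and>
     (\<forall>u\<in>S. settled_ok \<sigma> w s u) \<and>
     (\<forall>v<n. v \<notin> S \<longrightarrow> d v \<noteq> 0 \<longrightarrow>
        S = {} \<and> v = s \<and> p v = n \<or> p v \<in> S \<and> adj (p v) v \<and> d v = d (p v) + w v) \<and>
     (\<forall>x\<in>S. \<forall>y<n. y \<notin> S \<longrightarrow> adj x y \<longrightarrow> d y \<noteq> 0 \<and> d y \<le> d x + w y) \<and>
     (S = {} \<longrightarrow> d s = w s) \<and> (S \<noteq> {} \<longrightarrow> s \<in> S))"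

lemma dijkstraD:
  assumes "dijkstra \<sigma> w s"
  shows "graph_loaded \<sigma>" "rows_ok \<sigma>" "best_ok \<sigma>"
    and "v < n \<Longrightarrow> arr \<sigma> wtA v = w v"
    and "u \<in> settled \<sigma> \<Longrightarrow> settled_ok \<sigma> w s u"
    and "v < n \<Longrightarrow> v \<notin> settled \<sigma> \<Longrightarrow> arr \<sigma> distA v \<noteq> 0 \<Longrightarrow>
      settled \<sigma> = {} \<and> v = s \<and> arr \<sigma> parA v = n \<or>
      arr \<sigma> parA v \<in> settled \<sigma> \<and> adj (arr \<sigma> parA v) v \<and> arr \<sigma> distA v = arr \<sigma> distA (arr \<sigma> parA v) + w v"
    and "x \<in> settled \<sigma> \<Longrightarrow> y < n \<Longrightarrow> y \<notin> settled \<sigma> \<Longrightarrow> adj x y \<Longrightarrow>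
      arr \<sigma> distA y \<noteq> 0 \<and> arr \<sigma> distA y \<le> arr \<sigma> distA x + w y"
    and "settled \<sigma> = {} \<Longrightarrow> arr \<sigma> distA s = w s"
    and "settled \<sigma> \<noteq> {} \<Longrightarrow> s \<in> settled \<sigma>"
  using assms by (simp_all add: dijkstra_def Let_def)

lemma served_mono: "served adj V B k P \<Longrightarrow> k \<le> k' \<Longrightarrow> served adj V B k' P"
  by (auto simp: served_def Let_def)

text \<open>Once \<open>s\<close> is settled, a competitor \<open>X\<close> crosses from a linked
  settled part \<open>C\<close> to an unsettled \<open>y\<close>, since it contains
  \<open>u\<close>. The distance of \<open>u\<close> is at most that of \<open>y\<close>, which is
  at most the weight of \<open>insert y C\<close> and so of \<open>X\<close>.\<close>

lemma dijkstra_least: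
  assumes "dijkstra \<sigma> w s" and w: "\<And>v. v < n \<Longrightarrow> 0 < w v"
    and u: "u < n" "u \<notin> settled \<sigma>" "arr \<sigma> distA u \<noteq> 0"
    and min: "\<And>v. v < n \<Longrightarrow> arr \<sigma> distA v \<noteq> 0 \<Longrightarrow> v \<notin> settled \<sigma> \<Longrightarrow> arr \<sigma> distA u \<le> arr \<sigma> distA v"
    and X: "X \<subseteq> V" "s \<in> X" "u \<in> X" "linked adj X"
  shows "arr \<sigma> distA u \<le> sum w X"
proof -
  note D = dijkstraD[OF assms(1)]
  have "finite X" using X(1) finite_subset by blast
  show ?thesis
  proof (cases "settled \<sigma> = {}")
    case True
    then have "arr \<sigma> distA s = w s" "s < n" using D(8) X by auto
    then have "arr \<sigma> distA u \<le> w s" using min[of s] w[of s] True by simp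
    also have "\<dots> \<le> sum w X" using \<open>finite X\<close> X by (intro member_le_sum) auto
    finally show ?thesis .
  next
    case False
    then have "s \<in> settled \<sigma>" using D(9) by blast
    moreover have "\<not> X \<subseteq> settled \<sigma>" using u X by blast
    ultimately obtain C x y where C: "C \<subseteq> X \<inter> settled \<sigma>" "s \<in> C" "linked adj C" "x \<in> C"
        and y: "y \<in> X - settled \<sigma>" "adj x y"
      using linked_frontier[OF \<open>finite X\<close> X(4,2) _ _ symp_adj, of "settled \<sigma>"] by blast
    have x: "x \<in> settled \<sigma>" "C \<subseteq> V" "y < n" "finite C" using C y X \<open>finite X\<close> finite_subset by auto
    then have "settled_ok \<sigma> w s x" using D(5) by blast
    then have "arr \<sigma> distA x \<le> sum w C"
      using C x(2) unfolding settled_ok_def least_linked_def by metis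
    moreover have "arr \<sigma> distA y \<noteq> 0 \<and> arr \<sigma> distA y \<le> arr \<sigma> distA x + w y"
      using D(7) x y by blast
    moreover have "arr \<sigma> distA u \<le> arr \<sigma> distA y" using min[of y] x y calculation by blast
    moreover have "sum w C + w y = sum w (insert y C)" using C y x by (subst sum.insert) auto
    moreover have "\<dots> \<le> sum w X" using C y \<open>finite X\<close> by (intro sum_mono2) auto
    ultimately show ?thesis by linarith
  qed
qed

lemma run_settle:
  fixes \<sigma> u p
  defines "\<tau> \<equiv> run settle \<sigma>"
    and "mark \<equiv> (\<lambda>v. if v = u then 2 else if 0 < arr \<sigma> markA (p * n + v) then arr \<sigma> markA (p * n + v)
                    else if adj u v then 1 else 0)"
  assumes g: "graph_loaded \<sigma>" and u: "var \<sigma> uV = u" "u < n" and p: "arr \<sigma> parA u = p" "p \<le> n" "p \<noteq> u"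
  shows "\<forall>v<n. arr \<tau> markA (u * n + v) = mark v"
    and "\<forall>j. (\<forall>v<n. j \<noteq> u * n + v) \<longrightarrow> arr \<tau> markA j = arr \<sigma> markA j"
    and "var \<tau> coverBV = card ({v. v < n \<and> 0 < mark v} \<inter> B)"
    and "var \<tau> coverRV = card ({v. v < n \<and> 0 < mark v} - B)"
    and "var \<tau> pathBV = card ({v. v < n \<and> 1 < mark v} \<inter> B)"
    and "var \<tau> pathRV = card ({v. v < n \<and> 1 < mark v} - B)"
    and "arr \<tau> doneA = (arr \<sigma> doneA)(u := 1)" "var \<tau> rowV = u * n"
proof -
  define \<sigma>' where "\<sigma>' = set_var pathRV 0 (set_var pathBV 0 (set_var coverRV 0 (set_var coverBV 0
    (set_var rowV (u * n) (set_var parRowV (p * n) (set_arr doneA u 1 \<sigma>))))))"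
  have \<tau>: "\<tau> = run cover \<sigma>'"
    using g u p by (simp add: \<tau>_def settle_def \<sigma>'_def graph_loaded_def)
  have \<sigma>': "var \<sigma>' nV = n" "var \<sigma>' uV = u" "var \<sigma>' rowV = u * n" "var \<sigma>' parRowV = p * n"
      "var \<sigma>' coverBV = 0" "var \<sigma>' coverRV = 0" "var \<sigma>' pathBV = 0" "var \<sigma>' pathRV = 0"
      "arr \<sigma>' markA = arr \<sigma> markA" "arr \<sigma>' adjA = arr \<sigma> adjA" "arr \<sigma>' colA = arr \<sigma> colA"
    using g u by (simp_all add: \<sigma>'_def graph_loaded_def)
  note C = run_cover[of \<sigma>' n u p, OF \<sigma>'(1-4) p(3) \<sigma>'(5-8), folded \<tau>, unfolded \<sigma>'(9-11)]
  have adj: "arr \<sigma> adjA (u * n + v) = (if adj u v then 1 else 0)" if "v < n" for v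
    using g u that by (simp add: graph_loaded_def)
  have col: "v \<in> B \<longleftrightarrow> 0 < arr \<sigma> colA v" if "v < n" for v
    using g that by (simp add: graph_loaded_def)
  show "\<forall>v<n. arr \<tau> markA (u * n + v) = mark v" using C(1) adj by (simp add: mark_def)
  show "\<forall>j. (\<forall>v<n. j \<noteq> u * n + v) \<longrightarrow> arr \<tau> markA j = arr \<sigma> markA j" by (rule C(2))
  have cB: "card {v. v < n \<and> Q (f v) \<and> 0 < arr \<sigma> colA v} = card ({v. v < n \<and> Q (mark v)} \<inter> B)"
    and cR: "card {v. v < n \<and> Q (f v) \<and> \<not> 0 < arr \<sigma> colA v} = card ({v. v < n \<and> Q (mark v)} - B)"
    if "\<And>v. v < n \<Longrightarrow> f v = mark v" for Q and f :: "nat \<Rightarrow> nat"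
    using that col by (auto intro!: arg_cong[where f = card])
  show "var \<tau> coverBV = card ({v. v < n \<and> 0 < mark v} \<inter> B)"
    unfolding C(3) by (rule cB[where Q = "\<lambda>x. 0 < x"]) (simp add: mark_def adj)
  show "var \<tau> coverRV = card ({v. v < n \<and> 0 < mark v} - B)"
    unfolding C(4) by (rule cR[where Q = "\<lambda>x. 0 < x"]) (simp add: mark_def adj)
  show "var \<tau> pathBV = card ({v. v < n \<and> 1 < mark v} \<inter> B)"
    unfolding C(5) by (rule cB[where Q = "\<lambda>x. 1 < x"]) (simp add: mark_def adj)
  show "var \<tau> pathRV = card ({v. v < n \<and> 1 < mark v} - B)"
    unfolding C(6) by (rule cR[where Q = "\<lambda>x. 1 < x"]) (simp add: mark_def adj)
  show "arr \<tau> doneA = (arr \<sigma> doneA)(u := 1)" "var \<tau> rowV = u * n"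
    unfolding \<tau> by (subst run_frame; simp add: frame_sets \<sigma>'_def fun_eq_iff)+
qed

lemma run_improve:
  fixes \<sigma> u
  defines "\<tau> \<equiv> run improve \<sigma>" and "P \<equiv> marked \<sigma> u"
    and "N \<equiv> {v. v < n \<and> 0 < arr \<sigma> markA (u * n + v)}"
  assumes g: "graph_loaded \<sigma>" and best: "best_ok \<sigma>" and row: "var \<sigma> rowV = u * n"
    and counts: "var \<sigma> coverBV = card (N \<inter> B)" "var \<sigma> coverRV = card (N - B)"
      "var \<sigma> pathBV = card (P \<inter> B)" "var \<sigma> pathRV = card (P - B)"
    and P: "linked adj P" "P \<noteq> {}" "N = nbhd adj V P"
  shows "best_ok \<tau>" "served adj V B (var \<tau> bestV) P" "var \<sigma> bestV \<le> var \<tau> bestV"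
proof -
  define k where "k = min (card (N \<inter> B)) (card (N - B))"
  define C where "C \<longleftrightarrow> var \<sigma> bestV < k \<and> card (P \<inter> B) \<le> k \<and> card (P - B) \<le> k"
  define \<sigma>' where "\<sigma>' = set_var needRV (k - card (P - B)) (set_var needBV (k - card (P \<inter> B))
    (set_var bestV k (set_var sizeV k \<sigma>)))"
  have "card (N \<inter> B) - (card (N \<inter> B) - card (N - B)) = k" by (simp add: k_def)
  then have \<tau>: "\<tau> = (if C then run fill \<sigma>' else set_var sizeV k \<sigma>)"
    by (auto simp: \<tau>_def improve_def counts C_def \<sigma>'_def)
  have best': "best_ok \<tau> \<and> var \<tau> bestV = k" if C
  proof -
    have \<sigma>': "arr \<sigma>' markA = arr \<sigma> markA" "var \<sigma>' rowV = u * n" "arr \<sigma>' colA = arr \<sigma> colA"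
        "var \<sigma>' nV = n" "var \<sigma>' needBV = k - card (P \<inter> B)" "var \<sigma>' needRV = k - card (P - B)"
      using g row by (simp_all add: \<sigma>'_def graph_loaded_def)
    have col: "v \<in> B \<longleftrightarrow> 0 < arr \<sigma> colA v" if "v < n" for v
      using g that by (simp add: graph_loaded_def)
    have sets: "P \<inter> B = {v. v < n \<and> 1 < arr \<sigma> markA (u * n + v) \<and> 0 < arr \<sigma> colA v}"
        "P - B = {v. v < n \<and> 1 < arr \<sigma> markA (u * n + v) \<and> \<not> 0 < arr \<sigma> colA v}"
        "N \<inter> B = {v. v < n \<and> 0 < arr \<sigma> markA (u * n + v) \<and> 0 < arr \<sigma> colA v}"
        "N - B = {v. v < n \<and> 0 < arr \<sigma> markA (u * n + v) \<and> \<not> 0 < arr \<sigma> colA v}"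
      using col by (auto simp: P_def N_def marked_def)
    have "card (P \<inter> B) \<le> k" "card (P - B) \<le> k" "k \<le> card (N \<inter> B)" "k \<le> card (N - B)"
      using \<open>C\<close> by (simp_all add: C_def k_def)
    note F = run_fill[of \<sigma>' n k, unfolded \<sigma>', folded sets, OF refl refl refl this(1,3,2,4)]
    let ?W = "{v. v < n \<and> 0 < arr \<tau> outA v}"
    have "\<tau> = run fill \<sigma>'" using \<tau> \<open>C\<close> by simp
    note F = F[folded this]
    have "P \<subseteq> ?W" "?W \<subseteq> N" using F(1) by (auto simp: P_def N_def marked_def)
    then have "\<forall>v\<in>?W. v \<in> P \<or> (\<exists>p\<in>P. adj p v)"
      unfolding P(3) nbhd_def by blast
    then have "linked adj ?W"
      by (rule linked_superset[OF P(1,2) \<open>P \<subseteq> ?W\<close> _ symp_adj])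
    moreover have "?W \<inter> B = {v. v < n \<and> 0 < arr \<tau> outA v \<and> 0 < arr \<sigma> colA v}"
        "?W - B = {v. v < n \<and> 0 < arr \<tau> outA v \<and> \<not> 0 < arr \<sigma> colA v}"
      using col by auto
    moreover have "var \<tau> bestV = k"
      unfolding \<open>\<tau> = run fill \<sigma>'\<close> by (subst run_frame; simp add: frame_sets \<sigma>'_def)
    ultimately show ?thesis using F(2,3) by (simp add: best_ok_def Let_def)
  qed
  have same: "best_ok \<tau>" "var \<tau> bestV = var \<sigma> bestV" if "\<not> C"
    using that \<tau> best by (simp_all add: best_ok_def)
  show "best_ok \<tau>" using best' same by (cases C) simp_all
  show "var \<sigma> bestV \<le> var \<tau> bestV" using best' same by (cases C) (auto simp: C_def)
  \<comment> \<open>Without an improvement, either the best value is already at least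
    \<open>k\<close>, or \<open>P\<close> has more than \<open>k\<close> vertices of one color;
    \<open>served\<close> holds in both cases.\<close>
  show "served adj V B (var \<tau> bestV) P"
    using best' same unfolding served_def Let_def P(3)[symmetric] k_def[symmetric]
    by (cases C) (auto simp: C_def)
qed

lemma settled_ok_cong:
  assumes "settled_ok \<sigma> w s x" "\<And>v. v < n \<Longrightarrow> arr \<tau> markA (x * n + v) = arr \<sigma> markA (x * n + v)"
    and "arr \<tau> distA x = arr \<sigma> distA x" "var \<sigma> bestV \<le> var \<tau> bestV"
  shows "settled_ok \<tau> w s x"
proof -
  have "marked \<tau> x = marked \<sigma> x"
    "{v. v < n \<and> 0 < arr \<tau> markA (x * n + v)} = {v. v < n \<and> 0 < arr \<sigma> markA (x * n + v)}"
    using assms(2) by (auto simp: marked_def)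
  then show ?thesis
    using assms served_mono unfolding settled_ok_def by auto
qed

lemma dijkstra_cong:
  assumes "arr \<tau> = arr \<sigma>" "var \<tau> nV = var \<sigma> nV" "var \<tau> bestV = var \<sigma> bestV"
  shows "dijkstra \<tau> w s = dijkstra \<sigma> w s"
  using assms
  by (simp add: dijkstra_def graph_loaded_def rows_ok_def best_ok_def settled_ok_def settled_def marked_def)

lemma settle_improve:
  fixes \<sigma> u
  defines "\<tau> \<equiv> run improve (run settle \<sigma>)"
  assumes D: "dijkstra \<sigma> w s" and w: "\<And>v. v < n \<Longrightarrow> 0 < w v" and "s < n"
    and u: "var \<sigma> uV = u" "u < n" "u \<notin> settled \<sigma>" "arr \<sigma> distA u \<noteq> 0"
    and min: "\<And>v. v < n \<Longrightarrow> arr \<sigma> distA v \<noteq> 0 \<Longrightarrow> v \<notin> settled \<sigma> \<Longrightarrow> arr \<sigma> distA u \<le> arr \<sigma> distA v"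
  shows "rows_ok \<tau>" "best_ok \<tau>" "\<forall>x\<in>insert u (settled \<sigma>). settled_ok \<tau> w s x" "var \<sigma> bestV \<le> var \<tau> bestV"
    and "arr \<tau> doneA = (arr \<sigma> doneA)(u := 1)" "var \<tau> rowV = u * n"
proof -
  note D' = dijkstraD[OF D]
  define p where "p = arr \<sigma> parA u"
  define S where "S = settled \<sigma>"
  define \<rho> where "\<rho> = run settle \<sigma>"
  note g = D'(1) and rows = D'(2)
  have parent: "S = {} \<and> u = s \<and> p = n \<or> p \<in> S \<and> adj p u \<and> arr \<sigma> distA u = arr \<sigma> distA p + w u"
    using D'(6)[OF u(2-4)] unfolding p_def S_def .
  then have p: "p \<le> n" "p \<noteq> u" using u by (auto simp: S_def settled_def)
  define mark where "mark v = (if v = u then 2 else if 0 < arr \<sigma> markA (p * n + v)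
    then arr \<sigma> markA (p * n + v) else if adj u v then 1 else 0)" for v
  note R = run_settle[OF g u(1,2) p_def[symmetric] p, folded mark_def \<rho>_def]
  have row: "arr \<rho> markA (x * n + v) = arr \<sigma> markA (x * n + v)" if "x \<noteq> u" "v < n" for x v
    using R(2) row_index_inject[of v n _ x u] that by blast
  define P where "P = marked \<rho> u"
  have P_mark: "P = {v. v < n \<and> 1 < mark v}" using R(1) by (auto simp: P_def marked_def)
  also have "\<dots> = insert u (marked \<sigma> p)" using u(2) by (auto simp: mark_def marked_def)
  finally have P: "P = insert u (marked \<sigma> p)" .
  have N: "{v. v < n \<and> 0 < arr \<rho> markA (u * n + v)} = {v. v < n \<and> 0 < mark v}"
    using R(1) by auto
  have P_props: "linked adj P \<and> s \<in> P \<and> sum w P \<le> arr \<sigma> distA u \<and>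
      {v. v < n \<and> 0 < mark v} = nbhd adj V P \<and> (\<forall>v<n. mark v \<le> 2)"
  proof (cases "S = {}")
    case True
    then have p': "p = n" "u = s" "arr \<sigma> distA u = w s"
      using parent D'(8) by (auto simp: S_def)
    then have zero: "arr \<sigma> markA (p * n + v) = 0" if "v < n" for v
      using rows that by (simp add: rows_ok_def)
    then have "marked \<sigma> p = {}" by (simp add: marked_def)
    moreover have "{v. v < n \<and> 0 < mark v} = nbhd adj V {u}"
      using zero u by (auto simp: mark_def nbhd_def)
    ultimately show ?thesis
      using p' P linked_singleton[of adj u] zero by (simp add: mark_def)
  next
    case False
    then have ps: "p \<in> S" "adj p u" "arr \<sigma> distA u = arr \<sigma> distA p + w u" using parent by auto
    then have ok: "settled_ok \<sigma> w s p" using D'(5) by (simp add: S_def)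
    let ?Q = "marked \<sigma> p"
    have Q: "linked adj ?Q" "s \<in> ?Q" "p \<in> ?Q" "sum w ?Q = arr \<sigma> distA p" "\<forall>v<n. arr \<sigma> markA (p * n + v) \<le> 2"
        "nbhd adj V ?Q = {v. v < n \<and> 0 < arr \<sigma> markA (p * n + v)}"
      using ok by (auto simp: settled_ok_def least_linked_def)
    have "linked adj P"
      unfolding P by (rule linked_superset[OF Q(1)]) (use Q(3) ps symp_adj in auto)
    \<comment> \<open>Only an inequality, since nothing yet excludes that \<open>u\<close> belongs
      to the set of its parent. The converse comes from \<open>dijkstra_least\<close>.\<close>
    moreover have "sum w P \<le> arr \<sigma> distA u"
      unfolding P using ps Q(4) by (simp add: sum.insert_if marked_def)
    moreover have "nbhd adj V P = {v. v < n \<and> (v = u \<or> adj u v)} \<union> nbhd adj V ?Q"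
      using u by (auto simp: P nbhd_def)
    moreover have "0 < mark v \<longleftrightarrow> v = u \<or> adj u v \<or> 0 < arr \<sigma> markA (p * n + v)" for v
      by (simp add: mark_def)
    then have "{v. v < n \<and> 0 < mark v} = {v. v < n \<and> (v = u \<or> adj u v)} \<union> nbhd adj V ?Q"
      unfolding Q(6) by blast
    moreover have "\<forall>v<n. mark v \<le> 2" using Q(5) by (simp add: mark_def)
    moreover have "s \<in> P" using Q(2) by (simp add: P)
    ultimately show ?thesis by simp
  qed
  have PV: "P \<subseteq> V" "u \<in> P" using u by (auto simp: P marked_def)
  have least: "arr \<sigma> distA u \<le> sum w X" if "X \<subseteq> V" "s \<in> X" "u \<in> X" "linked adj X" for X
    by (rule dijkstra_least[OF D w u(2-4) min that])
  have dist: "sum w P = arr \<sigma> distA u" using least[of P] P_props PV by (simp add: le_antisym)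
  have \<rho>: "graph_loaded \<rho>" "best_ok \<rho>" "var \<rho> bestV = var \<sigma> bestV" "arr \<rho> distA = arr \<sigma> distA"
    using g D'(3) by (auto simp: \<rho>_def graph_loaded_def best_ok_def frame_settle)
  note I = run_improve[of \<rho> u, OF \<rho>(1,2) R(8), folded P_def, unfolded N, OF R(3,4)]
  have I: "best_ok \<tau>" "served adj V B (var \<tau> bestV) P" "var \<rho> bestV \<le> var \<tau> bestV"
    unfolding \<tau>_def \<rho>_def[symmetric]
    by (rule I; use R(5,6) P_props PV in \<open>auto simp: P_mark\<close>)+
  have \<tau>: "arr \<tau> markA = arr \<rho> markA" "arr \<tau> distA = arr \<sigma> distA" "marked \<tau> u = P"
    unfolding \<tau>_def \<rho>_def[symmetric] by (simp_all add: frame_improve \<rho> P_def marked_def)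
  show "best_ok \<tau>" by (rule I)
  show best: "var \<sigma> bestV \<le> var \<tau> bestV" using I \<rho> by simp
  show "rows_ok \<tau>" using rows row u by (auto simp: rows_ok_def \<tau>)
  show "arr \<tau> doneA = (arr \<sigma> doneA)(u := 1)" "var \<tau> rowV = u * n"
    unfolding \<tau>_def \<rho>_def[symmetric] by (simp_all add: frame_improve R)
  have "least_linked adj V w s u P"
    unfolding least_linked_def dist using P_props PV least by blast
  then have "settled_ok \<tau> w s u"
    unfolding settled_ok_def \<tau> using dist N P_props I(2) R(1) by simp
  moreover have "settled_ok \<tau> w s x" if "x \<in> settled \<sigma>" for x
  proof -
    have x: "settled_ok \<sigma> w s x" "x \<noteq> u" using that D'(5) u(3) by auto
    show ?thesis by (rule settled_ok_cong[OF x(1)]) (use row[of x] x(2) best \<tau> in simp_all)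
  qed
  ultimately show "\<forall>x\<in>insert u (settled \<sigma>). settled_ok \<tau> w s x" by blast
qed

definition exhausted :: "state \<Rightarrow> bool" where
  "exhausted \<sigma> \<longleftrightarrow> (\<forall>v<n. v \<notin> settled \<sigma> \<longrightarrow> arr \<sigma> distA v = 0)"

text \<open>The last conclusion is the progress measure that lets \<open>n\<close> rounds suffice:
  each round settles a new vertex unless the search is exhausted, and exhaustion persists.\<close>

lemma dijkstra_round:
  fixes \<sigma> defines "\<tau> \<equiv> run search_round \<sigma>"
  assumes D: "dijkstra \<sigma> w s" and w: "\<And>v. v < n \<Longrightarrow> 0 < w v" and s: "s < n"
  shows "dijkstra \<tau> w s" "var \<sigma> bestV \<le> var \<tau> bestV"
    and "exhausted \<tau> \<or> \<not> exhausted \<sigma> \<and> card (settled \<tau>) = Suc (card (settled \<sigma>))"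
proof -
  define \<sigma>' where "\<sigma>' = run find_min (set_var minV 0 \<sigma>)"
  have \<sigma>': "arr \<sigma>' = arr \<sigma>" "var \<sigma>' nV = var \<sigma> nV" "var \<sigma>' bestV = var \<sigma> bestV"
    by (simp_all add: \<sigma>'_def frame_find_min fun_eq_iff)
  have same: "settled \<sigma>' = settled \<sigma>" "exhausted \<sigma>' = exhausted \<sigma>"
    by (simp_all add: settled_def exhausted_def \<sigma>')
  have D': "dijkstra \<sigma>' w s" using D dijkstra_cong[OF \<sigma>'] by simp
  have n: "var \<sigma> nV = n" using D by (simp add: dijkstra_def graph_loaded_def Let_def)
  define u where "u = var \<sigma>' uV"
  define m where "m = var \<sigma>' minV"
  note F = run_find_min[of "set_var minV 0 \<sigma>", folded \<sigma>'_def m_def u_def, simplified, folded \<sigma>'(1), unfolded n]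
  have "dijkstra \<tau> w s \<and> var \<sigma> bestV \<le> var \<tau> bestV \<and>
    (exhausted \<tau> \<or> \<not> exhausted \<sigma> \<and> card (settled \<tau>) = Suc (card (settled \<sigma>)))"
  proof (cases "m = 0")
    case True
    then have "\<tau> = \<sigma>'" by (simp add: \<tau>_def search_round_def \<sigma>'_def m_def)
    moreover have "exhausted \<sigma>'" using F(1) True by (auto simp: exhausted_def settled_def)
    ultimately show ?thesis using D' \<sigma>' by simp
  next
    case False
    define \<rho> where "\<rho> = run improve (run settle \<sigma>')"
    have \<tau>: "\<tau> = run relax \<rho>"
      using False by (simp add: \<tau>_def search_round_def \<sigma>'_def[symmetric] m_def \<rho>_def)
    have u: "u < n" "arr \<sigma>' distA u = m" "arr \<sigma>' doneA u = 0" using F(2) False by auto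
    then have uS: "u \<notin> settled \<sigma>'" by (simp add: settled_def)
    have min: "arr \<sigma>' distA u \<le> arr \<sigma>' distA v" if "v < n" "arr \<sigma>' distA v \<noteq> 0" "v \<notin> settled \<sigma>'" for v
      using F(1)[of v] that u by (simp add: settled_def)
    have "arr \<sigma>' distA u \<noteq> 0" using u(2) False by simp
    note R = settle_improve[OF D' _ s u_def[symmetric] u(1) uS this]
    have R: "rows_ok \<rho>" "best_ok \<rho>" "\<forall>x\<in>insert u (settled \<sigma>'). settled_ok \<rho> w s x"
        "var \<sigma>' bestV \<le> var \<rho> bestV" "arr \<rho> doneA = (arr \<sigma>' doneA)(u := 1)" "var \<rho> rowV = u * n"
      unfolding \<rho>_def by (rule R; fact w min)+
    have \<rho>: "arr \<rho> distA = arr \<sigma>' distA" "arr \<rho> parA = arr \<sigma>' parA" "arr \<rho> wtA = arr \<sigma>' wtA"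
        "graph_loaded \<rho>" "var \<rho> minV = m" "var \<rho> uV = u"
      using dijkstraD(1)[OF D'] by (simp_all add: \<rho>_def graph_loaded_def frame_settle frame_improve m_def u_def)
    have wt: "\<And>v. v < n \<Longrightarrow> arr \<sigma>' wtA v = w v" by (rule dijkstraD(4)[OF D'])
    define S where "S = settled \<sigma>'"
    have \<tau>': "arr \<tau> doneA = (arr \<sigma>' doneA)(u := 1)" "arr \<tau> markA = arr \<rho> markA" "arr \<tau> wtA = arr \<sigma>' wtA"
        "arr \<tau> outA = arr \<rho> outA" "var \<tau> bestV = var \<rho> bestV" "graph_loaded \<tau>"
      using \<rho> R by (simp_all add: \<tau> frame_relax graph_loaded_def)
    have S': "settled \<tau> = insert u S" using u by (auto simp: settled_def \<tau>' S_def)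
    define upd where "upd v \<longleftrightarrow> v < n \<and> adj u v \<and> v \<notin> insert u S \<and>
      (arr \<sigma>' distA v = 0 \<or> m + w v < arr \<sigma>' distA v)" for v
    have upd: "(v < var \<rho> nV \<and> 0 < arr \<rho> adjA (var \<rho> rowV + v) \<and> arr \<rho> doneA v = 0 \<and>
          (arr \<rho> distA v = 0 \<or> var \<rho> minV + arr \<rho> wtA v < arr \<rho> distA v)) = upd v" for v
    proof (cases "v < n")
      case True
      have "arr \<rho> adjA (u * n + v) = (if adj u v then 1 else 0)" "var \<rho> nV = n"
        using \<rho>(4) u(1) True by (simp_all add: graph_loaded_def)
      moreover have "arr \<rho> doneA v = 0 \<longleftrightarrow> v \<notin> insert u S"
        using True by (simp add: R S_def settled_def)
      ultimately show ?thesis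
        using True wt[OF True] by (simp only: upd_def R(6) \<rho>) simp
    qed (use \<rho>(4) in \<open>simp add: upd_def graph_loaded_def\<close>)
    have relax: "arr \<tau> distA = (\<lambda>v. if upd v then var \<rho> minV + arr \<rho> wtA v else arr \<rho> distA v)"
        "arr \<tau> parA = (\<lambda>v. if upd v then var \<rho> uV else arr \<rho> parA v)"
      unfolding \<tau> run_relax upd by (rule refl)+
    have dist: "arr \<tau> distA v = (if upd v then m + w v else arr \<sigma>' distA v)"
      and par: "arr \<tau> parA v = (if upd v then u else arr \<sigma>' parA v)" for v
      by (auto simp: relax \<rho> upd_def wt)
    have "card (settled \<tau>) = Suc (card (settled \<sigma>))"
      using uS unfolding S' S_def same(1) by (subst card_insert_disjoint) (auto simp: settled_def)
    moreover have "\<not> exhausted \<sigma>'"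
      using u uS False by (auto simp: exhausted_def)
    then have "\<not> exhausted \<sigma>" using same(2) by simp
    moreover have "var \<sigma> bestV \<le> var \<tau> bestV" using R(4) \<tau>' \<sigma>' by simp
    moreover have "dijkstra \<tau> w s"
    proof -
      note old = dijkstraD(6)[OF D', folded S_def] and old' = dijkstraD(7)[OF D', folded S_def]
      \<comment> \<open>In the first round only \<open>s\<close> has a nonzero distance, hence
        \<open>u = s\<close>.\<close>
      have sS: "s \<in> insert u S"
        using dijkstraD(9)[OF D'] old[of u] u uS False by (auto simp: S_def)
      have keep: "x \<in> insert u S \<Longrightarrow> arr \<tau> distA x = arr \<sigma>' distA x" for x
        by (simp add: dist upd_def)
      have ok: "settled_ok \<tau> w s x" if "x \<in> insert u S" for x
        by (rule settled_ok_cong[of \<rho>]) (use that R(3) keep \<tau>' \<rho> in \<open>auto simp: S_def\<close>)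
      have tentative: "arr \<tau> parA v \<in> insert u S \<and> adj (arr \<tau> parA v) v \<and>
          arr \<tau> distA v = arr \<tau> distA (arr \<tau> parA v) + w v"
        if v: "v < n" "v \<notin> insert u S" "arr \<tau> distA v \<noteq> 0" for v
      proof (cases "upd v")
        case True
        then show ?thesis using keep[of u] u by (simp add: dist par) (simp add: upd_def)
      next
        case False
        then have "arr \<sigma>' distA v \<noteq> 0" using v by (simp add: dist)
        then have "arr \<sigma>' parA v \<in> S \<and> adj (arr \<sigma>' parA v) v \<and>
            arr \<sigma>' distA v = arr \<sigma>' distA (arr \<sigma>' parA v) + w v"
          using old[of v] v sS by blast
        then show ?thesis using False keep by (simp add: par) (simp add: dist)
      qed
      have relaxed: "arr \<tau> distA y \<noteq> 0 \<and> arr \<tau> distA y \<le> arr \<tau> distA x + w y"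
        if xy: "x \<in> insert u S" "y < n" "y \<notin> insert u S" "adj x y" for x y
      proof (cases "x = u")
        case True
        then show ?thesis using xy keep[of u] u False by (auto simp: dist upd_def)
      next
        case x: False
        then have "arr \<sigma>' distA y \<noteq> 0 \<and> arr \<sigma>' distA y \<le> arr \<sigma>' distA x + w y" using old'[of x y] xy by blast
        then show ?thesis using keep[OF xy(1)] False by (auto simp: dist upd_def)
      qed
      have "rows_ok \<tau>" "best_ok \<tau>" using R \<tau>' by (simp_all add: rows_ok_def best_ok_def)
      then show ?thesis
        unfolding dijkstra_def Let_def S' using \<tau>' wt ok tentative relaxed sS by simp
    qed
    ultimately show ?thesis by blast
  qed
  then show "dijkstra \<tau> w s" "var \<sigma> bestV \<le> var \<tau> bestV"
    and "exhausted \<tau> \<or> \<not> exhausted \<sigma> \<and> card (settled \<tau>) = Suc (card (settled \<sigma>))" by blast+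
qed

end

section \<open>Complete searches from all sources and for both weightings\<close>

context bcs_instance
begin

text \<open>What one search leaves to the next: the invariant without the data of a particular
  source.\<close>

definition ready :: "state \<Rightarrow> (nat \<Rightarrow> nat) \<Rightarrow> bool" where
  "ready \<sigma> w \<longleftrightarrow> graph_loaded \<sigma> \<and> rows_ok \<sigma> \<and> best_ok \<sigma> \<and> (\<forall>v<n. arr \<sigma> wtA v = w v)"

lemma ready_cong:
  assumes "\<And>a. a \<notin> {distA, doneA, parA} \<Longrightarrow> arr \<tau> a = arr \<sigma> a" "var \<tau> nV = var \<sigma> nV" "var \<tau> bestV = var \<sigma> bestV"
  shows "ready \<tau> w = ready \<sigma> w"
  using assms by (simp add: ready_def graph_loaded_def rows_ok_def best_ok_def)

lemma dijkstra_start: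
  assumes "ready \<sigma> w" "arr \<sigma> distA s = w s" "arr \<sigma> parA s = n"
    and "\<And>v. v < n \<Longrightarrow> arr \<sigma> doneA v = 0" "\<And>v. v < n \<Longrightarrow> v \<noteq> s \<Longrightarrow> arr \<sigma> distA v = 0"
  shows "dijkstra \<sigma> w s"
proof -
  have "settled \<sigma> = {}" using assms by (auto simp: settled_def)
  moreover have "\<forall>v<n. arr \<sigma> distA v \<noteq> 0 \<longrightarrow> v = s \<and> arr \<sigma> parA v = n" using assms(3,5) by metis
  ultimately show ?thesis using assms(1,2) by (simp add: dijkstra_def ready_def)
qed

lemma dijkstra_ready: "dijkstra \<sigma> w s \<Longrightarrow> ready \<sigma> w"
  by (simp add: ready_def dijkstra_def Let_def)

text \<open>Without pending distances, all neighbors of settled vertices are settled. So the settled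
  part of a linked \<open>X\<close> containing \<open>s\<close> is closed in \<open>X\<close> and
  equals \<open>X\<close>.\<close>

lemma exhausted_all_served:
  assumes D: "dijkstra \<sigma> w s" and "exhausted \<sigma>" "0 < w s" "s < n"
  shows "all_served adj V B w s (var \<sigma> bestV)"
  unfolding all_served_def
proof (intro allI impI)
  fix t X assume X: "X \<subseteq> V" "s \<in> X" "t \<in> X" "linked adj X"
  have s: "s \<in> settled \<sigma>"
  proof (rule ccontr)
    assume "s \<notin> settled \<sigma>"
    then have "arr \<sigma> distA s = w s" "arr \<sigma> distA s = 0"
      using dijkstraD(8,9)[OF D] assms by (auto simp: exhausted_def)
    then show False using \<open>0 < w s\<close> by simp
  qed
  have "X \<inter> settled \<sigma> = X"
  proof (rule linkedD[OF X(4)])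
    fix x y assume xy: "x \<in> X \<inter> settled \<sigma>" "y \<in> X" "adj x y"
    then have "y < n" using X by auto
    then show "y \<in> X \<inter> settled \<sigma>"
      using dijkstraD(7)[OF D, of x y] xy \<open>exhausted \<sigma>\<close> by (auto simp: exhausted_def)
  qed (use s X in auto)
  then have "settled_ok \<sigma> w s t" using dijkstraD(5)[OF D] X by blast
  then show "\<exists>P. least_linked adj V w s t P \<and> served adj V B (var \<sigma> bestV) P"
    by (auto simp: settled_ok_def)
qed

lemma run_search:
  fixes \<sigma> defines "\<tau> \<equiv> run search \<sigma>"
  assumes ready: "ready \<sigma> w" and w: "\<And>v. v < n \<Longrightarrow> 0 < w v" and s: "var \<sigma> sV = s" "s < n"
  shows "ready \<tau> w" "var \<sigma> bestV \<le> var \<tau> bestV" "all_served adj V B w s (var \<tau> bestV)"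
proof -
  let ?init = "For vV (Update distA (Var vV) (Num 0) ;; Update doneA (Var vV) (Num 0))"
  have n: "var \<sigma> nV = n" using ready by (simp add: ready_def graph_loaded_def)
  let ?I = "\<lambda>i \<tau>. \<forall>v<i. arr \<tau> distA v = 0 \<and> arr \<tau> doneA v = 0"
  have init: "?I (var \<sigma> nV) (run ?init \<sigma>)"
    by (rule For_invariant[where I = ?I]) (auto simp: less_Suc_eq)
  define \<rho> where "\<rho> = set_arr parA s n (set_arr distA s (w s) (run ?init \<sigma>))"
  have frame_var: "var (run ?init \<sigma>) x = var \<sigma> x" if "x \<noteq> vV" for x
    by (rule run_frame) (use that in simp)
  have frame_arr: "arr (run ?init \<sigma>) a = arr \<sigma> a" if "a \<notin> {distA, doneA}" for a
    by (rule run_frame) (use that in simp)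
  have "var (run ?init \<sigma>) sV = s" "var (run ?init \<sigma>) nV = n" "arr (run ?init \<sigma>) wtA s = w s"
    using s n ready by (simp_all add: frame_var frame_arr ready_def del: run.simps)
  then have \<tau>: "\<tau> = run (For roundV search_round) \<rho>"
    unfolding \<tau>_def search_def \<rho>_def by (simp del: run.simps(8))
  have "ready \<rho> w = ready \<sigma> w"
    by (rule ready_cong) (simp_all add: \<rho>_def frame_var frame_arr del: run.simps)
  then have start: "dijkstra \<rho> w s"
    using init ready n
    by (intro dijkstra_start) (simp_all add: \<rho>_def frame_var frame_arr del: run.simps)
  have \<rho>: "var \<rho> nV = n" "var \<rho> bestV = var \<sigma> bestV"
    using n by (simp_all add: \<rho>_def frame_var frame_arr del: run.simps)
  let ?J = "\<lambda>i \<tau>. dijkstra \<tau> w s \<and> var \<sigma> bestV \<le> var \<tau> bestV \<and> (exhausted \<tau> \<or> i \<le> card (settled \<tau>))"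
  have "?J (var \<rho> nV) \<tau>"
    unfolding \<tau>
  proof (rule For_invariant[where I = ?J], goal_cases)
    case 2
    have "dijkstra (set_var roundV 0 \<rho>) w s = dijkstra \<rho> w s" by (rule dijkstra_cong) simp_all
    then show ?case using start \<rho> by simp
  next
    case (3 i \<tau>')
    let ?\<tau> = "run search_round \<tau>'"
    have D: "dijkstra \<tau>' w s" using 3 by blast
    note R = dijkstra_round[OF D _ s(2)]
    have R: "dijkstra ?\<tau> w s" "var \<tau>' bestV \<le> var ?\<tau> bestV"
        "exhausted ?\<tau> \<or> \<not> exhausted \<tau>' \<and> card (settled ?\<tau>) = Suc (card (settled \<tau>'))"
      by (rule R; fact w)+
    have "dijkstra (set_var roundV (Suc i) ?\<tau>) w s = dijkstra ?\<tau> w s" by (rule dijkstra_cong) simp_all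
    moreover have "settled (set_var roundV (Suc i) ?\<tau>) = settled ?\<tau>"
        "exhausted (set_var roundV (Suc i) ?\<tau>) = exhausted ?\<tau>"
      by (simp_all add: settled_def exhausted_def)
    ultimately show ?case using R 3(2) by auto
  qed simp
  then have J: "dijkstra \<tau> w s" "var \<sigma> bestV \<le> var \<tau> bestV" "exhausted \<tau> \<or> n \<le> card (settled \<tau>)"
    using \<rho> by simp_all
  have "exhausted \<tau>"
  proof (rule disjE[OF J(3)])
    assume "n \<le> card (settled \<tau>)"
    moreover have "settled \<tau> \<subseteq> V" by (auto simp: settled_def)
    ultimately have "settled \<tau> = V" by (intro card_seteq) auto
    then show ?thesis by (simp add: exhausted_def)
  qed
  with J show "ready \<tau> w" "var \<sigma> bestV \<le> var \<tau> bestV" "all_served adj V B w s (var \<tau> bestV)"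
    using dijkstra_ready exhausted_all_served w s by auto
qed

lemma all_served_mono: "all_served adj V B w s k \<Longrightarrow> k \<le> k' \<Longrightarrow> all_served adj V B w s k'"
  unfolding all_served_def using served_mono by meson

lemma run_search_all:
  fixes \<sigma> defines "\<tau> \<equiv> run (For sV search) \<sigma>"
  assumes ready: "ready \<sigma> w" and w: "\<And>v. v < n \<Longrightarrow> 0 < w v"
  shows "ready \<tau> w" "var \<sigma> bestV \<le> var \<tau> bestV" "s < n \<Longrightarrow> all_served adj V B w s (var \<tau> bestV)"
proof -
  have n: "var \<sigma> nV = n" using ready by (simp add: ready_def graph_loaded_def)
  let ?I = "\<lambda>i \<tau>. ready \<tau> w \<and> var \<sigma> bestV \<le> var \<tau> bestV \<and> (\<forall>s<i. all_served adj V B w s (var \<tau> bestV))"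
  have "?I (var \<sigma> nV) \<tau>"
    unfolding \<tau>_def
  proof (rule For_invariant[where I = ?I], goal_cases)
    case 2
    have "ready (set_var sV 0 \<sigma>) w = ready \<sigma> w" by (rule ready_cong) simp_all
    then show ?case using ready by simp
  next
    case (3 i \<tau>')
    let ?\<tau> = "run search \<tau>'"
    have "ready \<tau>' w" "i < n" using 3 n by simp_all
    note R = run_search[OF this(1) _ 3(3) this(2)]
    have R: "ready ?\<tau> w" "var \<tau>' bestV \<le> var ?\<tau> bestV" "all_served adj V B w i (var ?\<tau> bestV)"
      by (rule R; fact w)+
    have "ready (set_var sV (Suc i) ?\<tau>) w = ready ?\<tau> w" by (rule ready_cong) simp_all
    moreover have "\<forall>s<i. all_served adj V B w s (var ?\<tau> bestV)"
      using 3(2) R(2) all_served_mono by blast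
    ultimately show ?case using R 3(2) by (auto simp: less_Suc_eq)
  qed simp
  then show "ready \<tau> w" "var \<sigma> bestV \<le> var \<tau> bestV" "s < n \<Longrightarrow> all_served adj V B w s (var \<tau> bestV)"
    using n by simp_all
qed

lemma run_weights:
  assumes "ready \<sigma> w" and "\<And>\<tau>. var \<tau> nV = n \<Longrightarrow> eval b \<tau> = cb" "\<And>\<tau>. var \<tau> nV = n \<Longrightarrow> eval r \<tau> = cr"
  shows "ready (run (weights b r) \<sigma>) (\<lambda>v. if v \<in> B then cb else cr)"
    and "var (run (weights b r) \<sigma>) bestV = var \<sigma> bestV"
proof -
  let ?\<tau> = "run (weights b r) \<sigma>"
  have n: "var \<sigma> nV = n" and col: "\<And>v. v < n \<Longrightarrow> 0 < arr \<sigma> colA v \<longleftrightarrow> v \<in> B"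
    using assms(1) by (simp_all add: ready_def graph_loaded_def)
  let ?I = "\<lambda>i \<tau>. \<forall>v<i. arr \<tau> wtA v = (if v \<in> B then cb else cr)"
  have "?I (var \<sigma> nV) ?\<tau>"
    unfolding weights_def
  proof (rule For_invariant[where I = ?I], goal_cases)
    case (3 i \<tau>)
    have "var \<tau> nV = n" "arr \<tau> colA = arr \<sigma> colA" using 3(4) n by (simp_all add: frame_def)
    then show ?case using 3 assms(2,3)[of \<tau>] col[of i] n by (simp add: less_Suc_eq)
  qed simp_all
  moreover have "writes (weights b r) = {vV}" "arr_writes (weights b r) = {wtA}"
    by (simp_all add: weights_def)
  ultimately show "ready ?\<tau> (\<lambda>v. if v \<in> B then cb else cr)" "var ?\<tau> bestV = var \<sigma> bestV"
    using assms(1) n by (simp_all add: ready_def graph_loaded_def rows_ok_def best_ok_def run_frame)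
qed

lemma run_read_graph:
  fixes \<sigma> defines "\<tau> \<equiv> run read_graph \<sigma>"
  assumes n: "var \<sigma> nV = n" and base: "var \<sigma> baseV = 0"
    and ins: "ins \<sigma> = map (\<lambda>v. if v \<in> B then 1 else 0) [0..<n] @
      concat (map (\<lambda>u. map (\<lambda>v. if adj u v then 1 else 0) [0..<n]) [0..<n])"
  shows "graph_loaded \<tau>"
proof -
  let ?row = "\<lambda>u. map (\<lambda>v. if adj u v then 1 else 0) [0..<n] :: nat list"
  let ?rows = "\<lambda>u. concat (map ?row [u..<n])"
  let ?cols = "For vV (Get inV ;; Update colA (Var vV) (Var inV))"
  let ?read = "For vV (Get inV ;; Update adjA (Plus (Var baseV) (Var vV)) (Var inV))"
  let ?body = "Update rowA (Var sV) (Var baseV) ;; ?read ;; Assign baseV (Plus (Var baseV) (Var nV))"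
  define \<sigma>' where "\<sigma>' = run ?cols \<sigma>"
  let ?I = "\<lambda>i \<tau>. (\<forall>v<i. 0 < arr \<tau> colA v \<longleftrightarrow> v \<in> B) \<and>
    ins \<tau> = map (\<lambda>v. if v \<in> B then 1 else 0) [i..<n] @ ?rows 0"
  have "?I (var \<sigma> nV) \<sigma>'"
    unfolding \<sigma>'_def
  proof (rule For_invariant[where I = ?I], goal_cases)
    case (3 i \<tau>)
    then show ?case using n by (auto simp: upt_conv_Cons less_Suc_eq)
  qed (use ins in simp_all)
  moreover have "var \<sigma>' nV = n" "var \<sigma>' baseV = 0"
    using n base unfolding \<sigma>'_def by (subst run_frame; simp)+
  ultimately have \<sigma>': "\<And>v. v < n \<Longrightarrow> 0 < arr \<sigma>' colA v \<longleftrightarrow> v \<in> B" "ins \<sigma>' = ?rows 0"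
      "var \<sigma>' nV = n" "var \<sigma>' baseV = 0"
    using n by simp_all
  define \<rho> where "\<rho> = run (For sV ?body) \<sigma>'"
  let ?J = "\<lambda>i \<tau>. var \<tau> baseV = i * n \<and> ins \<tau> = ?rows i \<and> (\<forall>u<i. arr \<tau> rowA u = u * n) \<and>
    (\<forall>u<i. \<forall>v<n. arr \<tau> adjA (u * n + v) = (if adj u v then 1 else 0))"
  have J: "?J (var \<sigma>' nV) \<rho>"
    unfolding \<rho>_def
  proof (rule For_invariant[where I = ?J], goal_cases)
    case (3 i \<tau>)
    have i: "i < n" and nt: "var \<tau> nV = n" using 3 \<sigma>' by (simp_all add: frame_def)
    define \<tau>' where "\<tau>' = set_arr rowA i (i * n) \<tau>"
    let ?K = "\<lambda>j \<rho>. ins \<rho> = map (\<lambda>v. if adj i v then 1 else 0) [j..<n] @ ?rows (Suc i) \<and>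
      (\<forall>v<j. arr \<rho> adjA (i * n + v) = (if adj i v then 1 else 0)) \<and>
      (\<forall>u<i. \<forall>v<n. arr \<rho> adjA (u * n + v) = (if adj u v then 1 else 0))"
    have "?K (var \<tau>' nV) (run ?read \<tau>')"
    proof (rule For_invariant[where I = ?K], goal_cases)
      case 2
      have "?rows i = ?row i @ ?rows (Suc i)" using i by (simp add: upt_conv_Cons)
      then show ?case using 3(2) by (simp add: \<tau>'_def)
    next
      case (3 j \<rho>)
      then have j: "j < n" using nt by (simp add: \<tau>'_def)
      have "var \<rho> baseV = i * n"
        using 3(4) \<open>?J i \<tau>\<close> by (simp add: frame_def \<tau>'_def)
      moreover have "u * n + v \<noteq> i * n + j" if "u < i" "v < n" for u v
        using row_index_inject[of v n j u i] that j by simp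
      ultimately show ?case using 3 j by (auto simp: upt_conv_Cons less_Suc_eq)
    qed simp
    then have K: "?K n (run ?read \<tau>')" using nt by (simp add: \<tau>'_def)
    have fr: "var (run ?read \<tau>') x = var \<tau> x" "arr (run ?read \<tau>') a = arr \<tau>' a"
      if "x \<notin> {vV, inV}" "a \<noteq> adjA" for x a
      using that by (subst run_frame; simp add: \<tau>'_def)+
    have "run ?body \<tau> = set_var baseV (i * n + n) (run ?read \<tau>')"
      using 3 nt fr[of baseV 0] fr[of nV 0] by (simp add: \<tau>'_def del: run.simps(8))
    then show ?case
      using K 3(2) fr[of 0 rowA] by (auto simp: less_Suc_eq \<tau>'_def simp del: run.simps(8))
  qed (use \<sigma>' in simp_all)
  have "\<tau> = set_arr rowA n (n * n) \<rho>"
  proof -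
    have "\<tau> = run (Update rowA (Var nV) (Var baseV)) \<rho>"
      by (simp add: \<tau>_def read_graph_def \<rho>_def \<sigma>'_def)
    moreover have "var \<rho> nV = n" using \<sigma>' unfolding \<rho>_def by (subst run_frame; simp)
    ultimately show ?thesis using J \<sigma>' by simp
  qed
  moreover have "var \<rho> nV = n" "arr \<rho> colA = arr \<sigma>' colA"
    using \<sigma>' unfolding \<rho>_def by (subst run_frame; simp)+
  ultimately show ?thesis
    using J \<sigma>' by (auto simp: graph_loaded_def)
qed

lemma run_solve:
  fixes \<sigma> defines "\<tau> \<equiv> run solve \<sigma>"
  assumes n: "var \<sigma> nV = n" and zero: "\<And>x. x \<noteq> nV \<Longrightarrow> var \<sigma> x = 0" "\<And>a i. arr \<sigma> a i = 0" "outs \<sigma> = []"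
    and ins: "ins \<sigma> = map (\<lambda>v. if v \<in> B then 1 else 0) [0..<n] @
      concat (map (\<lambda>u. map (\<lambda>v. if adj u v then 1 else 0) [0..<n]) [0..<n])"
  obtains W k where "outs \<tau> = filter (\<lambda>v. v \<in> W) [0..<n]" "W \<subseteq> V" "linked adj W"
    "card (W \<inter> B) = k" "card (W - B) = k"
    "\<And>s. s \<in> V \<Longrightarrow> all_served adj V B (weight n B) s k"
    "\<And>s. s \<in> V \<Longrightarrow> all_served adj V B (weight n (V - B)) s k"
proof -
  define \<sigma>1 where "\<sigma>1 = run read_graph \<sigma>"
  define \<sigma>2 where "\<sigma>2 = run (weights (Plus (Var nV) (Num 1)) (Num 1)) \<sigma>1"
  define \<sigma>3 where "\<sigma>3 = run (For sV search) \<sigma>2"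
  define \<sigma>4 where "\<sigma>4 = run (weights (Num 1) (Plus (Var nV) (Num 1))) \<sigma>3"
  define \<sigma>5 where "\<sigma>5 = run (For sV search) \<sigma>4"
  let ?print = "For vV (When (At outA) (Put (Var vV)))"
  have \<tau>: "\<tau> = run ?print \<sigma>5"
    unfolding \<tau>_def solve_def \<sigma>1_def \<sigma>2_def \<sigma>3_def \<sigma>4_def \<sigma>5_def by simp
  have g: "graph_loaded \<sigma>1"
    unfolding \<sigma>1_def by (rule run_read_graph) (use n zero ins in simp_all)
  have "arr \<sigma>1 markA = arr \<sigma> markA" "arr \<sigma>1 outA = arr \<sigma> outA" "var \<sigma>1 bestV = var \<sigma> bestV"
    unfolding \<sigma>1_def by (subst run_frame; simp add: read_graph_def)+
  \<comment> \<open>No weights have been set yet, so the current contents of the array stand in for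
    a weight function. The best set is initially empty, with value \<open>0\<close>.\<close>
  then have r1: "ready \<sigma>1 (arr \<sigma>1 wtA)"
    using g zero by (simp add: ready_def rows_ok_def best_ok_def linked_def)
  let ?wB = "weight n B" and ?wR = "weight n (V - B)"
  have "ready \<sigma>2 (\<lambda>v. if v \<in> B then Suc n else 1)"
    unfolding \<sigma>2_def by (rule run_weights[OF r1]) simp_all
  then have r2: "ready \<sigma>2 ?wB" by (simp add: ready_def weight_def)
  note S3 = run_search_all[OF r2, folded \<sigma>3_def]
  have S3: "ready \<sigma>3 ?wB" "\<And>s. s < n \<Longrightarrow> all_served adj V B ?wB s (var \<sigma>3 bestV)"
    by (rule S3; simp add: weight_def)+
  note W4 = run_weights[OF S3(1), of "Num 1" 1 "Plus (Var nV) (Num 1)" "Suc n", folded \<sigma>4_def, simplified]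
  then have r4: "ready \<sigma>4 ?wR" by (simp add: ready_def weight_def)
  note S5 = run_search_all[OF r4, folded \<sigma>5_def]
  have S5: "ready \<sigma>5 ?wR" "var \<sigma>4 bestV \<le> var \<sigma>5 bestV"
      "\<And>s. s < n \<Longrightarrow> all_served adj V B ?wR s (var \<sigma>5 bestV)"
    by (rule S5; simp add: weight_def)+
  \<comment> \<open>The second pass can only raise the best value, so what the first pass served
    stays served.\<close>
  have sB: "all_served adj V B ?wB s (var \<sigma>5 bestV)" if "s < n" for s
    using all_served_mono[OF S3(2)[OF that]] S5(2) W4(2) by simp
  define W where "W = {v. v < n \<and> 0 < arr \<sigma>5 outA v}"
  have best: "best_ok \<sigma>5" and n5: "var \<sigma>5 nV = n"
    using S5(1) by (simp_all add: ready_def graph_loaded_def)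
  have "outs \<sigma>5 = outs \<sigma>"
    unfolding \<sigma>5_def \<sigma>4_def \<sigma>3_def \<sigma>2_def \<sigma>1_def
    by (simp add: run_frame program_defs del: run.simps)
  then have outs5: "outs \<sigma>5 = []" using zero by simp
  let ?I = "\<lambda>i \<tau>. outs \<tau> = filter (\<lambda>v. v \<in> W) [0..<i]"
  have "?I (var \<sigma>5 nV) \<tau>"
    unfolding \<tau>
  proof (rule For_invariant[where I = ?I], goal_cases)
    case (3 i \<tau>')
    then show ?case using n5 by (auto simp: frame_def W_def)
  qed (use outs5 in simp_all)
  then have "outs \<tau> = filter (\<lambda>v. v \<in> W) [0..<n]" using n5 by simp
  then show thesis
    by (rule that[of W "var \<sigma>5 bestV"]) (use best sB S5(3) in \<open>auto simp: best_ok_def W_def Let_def\<close>)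
qed

end

text \<open>Well-formed commands cannot assign variable \<open>0\<close>, so the number of vertices
  is fetched by a bare \<open>Read\<close> in front of the compiled code. Hence the start position
  \<open>1\<close> and the additional step.\<close>

lemma computes_within_comp:
  fixes n xs
  assumes "wf_com c" "0 \<notin> writes c"
  defines "\<sigma> \<equiv> \<lparr>var = (\<lambda>_. 0)(0 := n), arr = (\<lambda>_ _. 0), ins = xs, outs = []\<rparr>"
  shows "computes_within (Read 0 # comp c 1) (n # xs) (Suc (cost c n)) (outs (run c \<sigma>))"
proof -
  let ?P = "Read 0 # comp c 1"
  let ?s = "step ?P (initial (n # xs))"
  have s: "?s = \<lparr>pc = 1, reg = (\<lambda>_. 0)(0 := n), inp = xs, outp = []\<rparr>"
    by (simp add: step_def halted_def initial_def)
  have "code_at ?P 1 (comp c 1)"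
    unfolding code_at_def by (intro exI[of _ "[Read 0]"] exI[of _ "[]"]) simp
  moreover have "represents ?s \<sigma>" unfolding s by (simp add: represents_def \<sigma>_def)
  ultimately have "reaches ?P ?s (1 + length (comp c 1)) (run c \<sigma>) (cost c (var \<sigma> 0))"
    by (intro comp_correct[OF assms(1)]) (simp_all only: s config.simps)
  then obtain j where j: "j \<le> cost c n" "pc ((step ?P ^^ j) ?s) = 1 + length (comp c 1)"
      "represents ((step ?P ^^ j) ?s) (run c \<sigma>)"
    by (auto simp: reaches_def \<sigma>_def)
  then show ?thesis
    unfolding computes_within_def Let_def
    by (intro exI[of _ "Suc j"]) (simp add: funpow_Suc_right halted_def represents_def del: funpow.simps)
qed

section \<open>From the program to bicolored interval graphs\<close>

lemma solve_optimal:
  assumes G: "bicolored_graph G" "verts G = {..<n}" "interval_graph G"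
  shows "\<exists>ys H. computes_within (Read 0 # comp solve 1) (encode_graph n G) (Suc (cost solve n)) ys \<and>
    distinct ys \<and> set ys = verts H \<and> bcs_optimal G H"
proof -
  define adj where "adj = (\<lambda>u v. {u, v} \<in> edges G)"
  define B where "B = blue G"
  have irrefl: "\<not> adj v v" for v using G(1) by (auto simp: adj_def bicolored_graph_def)
  interpret bcs_instance n adj B
    by unfold_locales (auto simp: symp_def adj_def insert_commute)
  obtain L R :: "nat \<Rightarrow> real" where "\<And>v. v \<in> V \<Longrightarrow> L v \<le> R v"
      "\<And>u v. u \<in> V \<Longrightarrow> v \<in> V \<Longrightarrow> u \<noteq> v \<Longrightarrow> adj u v \<longleftrightarrow> L u \<le> R v \<and> L v \<le> R u"
    using interval_graph_endpoints[OF G(1,3)] unfolding G(2) adj_def by blast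
  then interpret interval_rep V adj L R
    using irrefl by unfold_locales auto
  define \<sigma> where "\<sigma> = \<lparr>var = (\<lambda>_. 0)(0 := n), arr = (\<lambda>_ _. 0), ins = tl (encode_graph n G), outs = []\<rparr>"
  obtain W k where W: "outs (run solve \<sigma>) = filter (\<lambda>v. v \<in> W) [0..<n]" "W \<subseteq> V" "linked adj W"
      "card (W \<inter> B) = k" "card (W - B) = k"
      and served: "\<And>s. s \<in> V \<Longrightarrow> all_served adj V B (weight n B) s k"
        "\<And>s. s \<in> V \<Longrightarrow> all_served adj V B (weight n (V - B)) s k"
    by (rule run_solve[of \<sigma>]) (simp_all add: \<sigma>_def encode_graph_def adj_def B_def)
  have colors: "blue (induced_subgraph G X) = X \<inter> B" "red (induced_subgraph G X) = X - B"
      "verts (induced_subgraph G X) = X" if "X \<subseteq> V" for X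
    using that G(1) unfolding G(2)[symmetric]
    by (auto simp: induced_subgraph_def verts_def B_def bicolored_graph_def)
  have connected: "connected_graph (induced_subgraph G X) \<longleftrightarrow> linked adj X" if "X \<subseteq> V" for X
    using connected_induced_iff_linked[OF G(1)] that G(2) by (simp add: adj_def)
  have card: "card X = card (X \<inter> B) + card (X - B)" if "X \<subseteq> V" for X
    using that finite_subset by (subst card_Un_disjoint[symmetric]) (auto intro: arg_cong[where f = card])
  let ?H = "induced_subgraph G W"
  have "bcs_feasible G ?H"
    unfolding bcs_feasible_def using W G(2) by (auto simp: colors connected)
  moreover have "card (verts H') \<le> card (verts ?H)" if feasible: "bcs_feasible G H'" for H'
  proof -
    obtain X where X: "X \<subseteq> V" "H' = induced_subgraph G X" "linked adj X" "card (X \<inter> B) = card (X - B)"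
      using feasible unfolding bcs_feasible_def G(2) by (auto simp: colors connected)
    have "card (X \<inter> B) \<le> k"
      using balanced_linked_bound[of B k X] served X by simp
    then show ?thesis using X W by (simp add: colors card[of X] card[of W])
  qed
  ultimately have "bcs_optimal G ?H" by (simp add: bcs_optimal_def)
  moreover have "computes_within (Read 0 # comp solve 1) (encode_graph n G) (Suc (cost solve n)) (outs (run solve \<sigma>))"
  proof -
    have "encode_graph n G = n # tl (encode_graph n G)" by (simp add: encode_graph_def)
    moreover have "0 \<notin> writes solve" by (simp add: program_defs)
    ultimately show ?thesis using computes_within_comp[OF wf_solve] unfolding \<sigma>_def by metis
  qed
  ultimately show ?thesis
    using W(1,2) by (intro exI[of _ "outs (run solve \<sigma>)"] exI[of _ ?H]) (auto simp: colors)
qed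

theorem theorem4:
  "\<exists>(P :: instr list) (T :: nat \<Rightarrow> nat).
     (\<lambda>n. real (T n)) \<in> O(\<lambda>n. real n ^ 3) \<and>
     (\<forall>(n :: nat) (G :: nat bicolored).
        bicolored_graph G \<and> verts G = {..<n} \<and> interval_graph G \<longrightarrow>
        (\<exists>ys H. computes_within P (encode_graph n G) (T n) ys \<and>
           distinct ys \<and> set ys = verts H \<and> bcs_optimal G H))"
proof (rule exI[of _ "Read 0 # comp solve 1"], rule exI[of _ "\<lambda>n. Suc (cost solve n)"],
    intro conjI allI impI)
  obtain C where C: "\<And>n. cost solve n \<le> C * Suc n ^ 3"
    using cost_polynomial[of solve] unfolding depth_solve by blast
  show "(\<lambda>n. real (Suc (cost solve n))) \<in> O(\<lambda>n. real n ^ 3)"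
  proof (rule bigoI)
    \<comment> \<open>The factor \<open>8\<close> is the cube of \<open>2\<close> in
      \<open>Suc n \<le> 2 * n\<close>, valid from \<open>n = 1\<close> on. The added
      \<open>1\<close> pays for the initial \<open>Read\<close>.\<close>
    show "eventually (\<lambda>n. norm (real (Suc (cost solve n))) \<le> real (8 * C + 1) * norm (real n ^ 3)) at_top"
    proof (rule eventually_mono[OF eventually_ge_at_top[of 1]])
      fix n :: nat assume n: "1 \<le> n"
      have "Suc n ^ 3 \<le> (2 * n) ^ 3" using n by (intro power_mono) auto
      then have "C * Suc n ^ 3 \<le> C * (8 * n ^ 3)" by (intro mult_le_mono2) (simp add: power_mult_distrib)
      then have "cost solve n \<le> C * (8 * n ^ 3)" using C[of n] by (rule order_trans[rotated])
      moreover have "1 \<le> n ^ 3" using n by simp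
      ultimately have "Suc (cost solve n) \<le> C * (8 * n ^ 3) + n ^ 3" by linarith
      then have "Suc (cost solve n) \<le> (8 * C + 1) * n ^ 3" by (simp add: algebra_simps)
      then have "real (Suc (cost solve n)) \<le> real ((8 * C + 1) * n ^ 3)" by (rule of_nat_mono)
      then show "norm (real (Suc (cost solve n))) \<le> real (8 * C + 1) * norm (real n ^ 3)"
        by (simp add: algebra_simps)
    qed
  qed
  fix n :: nat and G :: "nat bicolored"
  assume "bicolored_graph G \<and> verts G = {..<n} \<and> interval_graph G"
  then show "\<exists>ys H. computes_within (Read 0 # comp solve 1) (encode_graph n G) (Suc (cost solve n)) ys \<and>
      distinct ys \<and> set ys = verts H \<and> bcs_optimal G H"
    using solve_optimal by blast
qed

end
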